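(* Let $p\in(0,1)$ be fixed (independent of $n$). Let $f(x,y)$ be a symmetric real function of two positive real variables with $f(a,b)>0$ for all integers $a,b\ge 1$ (positivity of edge weights). Suppose that: (i) there are constants $C,m>0$ such that $|f(a,b)|\le C n^m$ and $1/|f(a,b)|\le C n^m$ for all $n$ and all integers $1\le a,b\le n-1$ (that is, for all possible values $a=d_i$, $b=d_j$ of the degrees of the end-vertices of an edge $ij$ of a graph on $n$ vertices); (ii) $f(np,np)\ne 0$ and $f((1+o(1))np,(1+o(1))np)=(1+o(1))f(np,np)$ as $n\to\infty$, i.e. $f(x_n,y_n)/f(np,np)\to 1$ whenever $x_n/(np)\to 1$ and $y_n/(np)\to 1$. Then for almost all weighted random graphs $G_p(f)$ in $G_{n,p}(f)$, the energy satisfies $$\mathscr{E}(A(G_p(f)))=(1+o(1))\,f(np,np)\,\frac{8}{3\pi}\sqrt{p(1-p)}\cdot n^{3/2}.$$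
   Context: $G_p$ denotes an Erdős–Rényi random graph in $G_{n,p}$: a random simple graph on vertex set $\{1,\dots,n\}$ in which each edge is present independently with probability $p$. For a vertex $i$, $d_i$ is its degree in $G_p$. The weighted random graph $G_p(f)$ in $G_{n,p}(f)$ is obtained from $G_p$ by giving each edge $ij$ of $G_p$ the weight $f(d_i,d_j)$; its adjacency matrix $A(G_p(f))$ is the symmetric $n\times n$ matrix with $(i,j)$-entry $f(d_i,d_j)$ if $ij$ is an edge of $G_p$ and $0$ otherwise. The energy of a real symmetric $n\times n$ matrix $A$ with eigenvalues $\lambda_1,\dots,\lambda_n$ is $\mathscr{E}(A)=\sum_{i=1}^n|\lambda_i|$. "Almost all" means with probability tending to $1$ as $n\to\infty$; thus the assertion "for almost all graphs, $\mathscr{E}=(1+o(1))g(n)$" means that for every $\varepsilon>0$, $\Pr\big(|\mathscr{E}/g(n)-1|>\varepsilon\big)\to 0$ as $n\to\infty$. *)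

theory Defs
  imports "HOL-Probability.Probability" "Jordan_Normal_Form.Char_Poly"
begin

text \<open>A graph on the vertex set \<open>{1..n}\<close> is represented by its set of edges, each edge being a
  two-element subset of \<open>{1..n}\<close>.\<close>

definition all_edges :: "nat \<Rightarrow> nat set set" where
  "all_edges n = {e. e \<subseteq> {1..n} \<and> card e = 2}"

definition gnp :: "nat \<Rightarrow> real \<Rightarrow> nat set set pmf" where
  "gnp n p = map_pmf (\<lambda>X. {e. X e}) (Pi_pmf (all_edges n) False (\<lambda>_. bernoulli_pmf p))"

definition degree_of :: "nat set set \<Rightarrow> nat \<Rightarrow> nat" where
  "degree_of E i = card {e \<in> E. i \<in> e}"

text \<open>Matrix indices start at 0, so row (or column) \<open>i\<close> belongs to vertex \<open>Suc i\<close>.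
  The constant is qualified because \<open>HOL-Analysis\<close> also has one called \<open>mat\<close>.\<close>

definition weighted_adj ::
  "(real \<Rightarrow> real \<Rightarrow> real) \<Rightarrow> nat \<Rightarrow> nat set set \<Rightarrow> real Matrix.mat" where
  "weighted_adj f n E = Matrix.mat n n (\<lambda>(i, j).
     if {Suc i, Suc j} \<in> E then f (real (degree_of E (Suc i))) (real (degree_of E (Suc j))) else 0)"

text \<open>Eigenvalues are counted with their multiplicity as roots of the characteristic polynomial.
  Only real eigenvalues are summed; for a real symmetric matrix these are all of them.\<close>

definition energy :: "real Matrix.mat \<Rightarrow> real" where
  "energy A = (\<Sum>x | eigenvalue A x. real (Polynomial.order x (char_poly A)) * \<bar>x\<bar>)"

end

theory Submission
  imports Defs "HOL-Real_Asymp.Real_Asymp"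
begin

text \<open>
  Write \<open>A\<close> for the adjacency matrix of the random graph, \<open>v = p(1 - p)\<close>, and \<open>X\<close> for the matrix that has
  the entries of \<open>(A - p) / sqrt n\<close> off the diagonal and zeros on it. The energy is the trace norm, and
  the proof has two halves: the energy of the weighted matrix differs little from that of a multiple
  of \<open>X\<close>, and \<open>energy X / n\<close> tends to \<open>8 sqrt v / (3 pi)\<close> in probability.

  For the first half, all degrees are close to \<open>np\<close> with high probability (\<open>degrees_concentrated\<close>), so
  by the regularity of \<open>f\<close> every weight is \<open>c (1 + o(1))\<close> with \<open>c = f(np, np)\<close>. Replacing all weights by
  \<open>c\<close> changes each entry by at most \<open>c \<delta>\<close>, and an entrywise change of size \<open>\<eta>\<close> moves the trace norm by at most
  \<open>sqrt n\<close> times the Frobenius norm, hence by at most \<open>n powr (3 / 2) * \<eta>\<close>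
  (\<open>energy_diff_le_entrywise\<close>). This is of lower order than the claimed \<open>n powr (3 / 2)\<close>. Subtracting \<open>p\<close> off
  the diagonal costs only \<open>2pn\<close>, because the matrix with all entries 1 has trace norm \<open>n\<close>.

  For the second half, Coulson's formula \<open>\<bar>x\<bar> = 2 / pi * \<integral> x\<^sup>2 / (x\<^sup>2 + t\<^sup>2) dt\<close> over \<open>t > 0\<close> expresses the
  energy of \<open>X\<close> by the normalised resolvent trace \<open>s(t) = tr (X - it)\<^sup>-\<^sup>1 / n\<close>. Only
  spectral parameters on the imaginary axis occur, where the resolvent entries are bounded by \<open>1 / t\<close>
  whatever the graph is. Resampling a single edge in \<open>X (X - it)\<^sup>-\<^sup>1 = 1 + it (X - it)\<^sup>-\<^sup>1\<close> and expanding the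
  resolvent to first order gives \<open>1 + it E s + v E s\<^sup>2 = O(1 / sqrt n)\<close> (\<open>stieltjes_loop_equation\<close>).
  The variance of \<open>s\<close> is \<open>O(1 / n)\<close>, so \<open>E s\<close> nearly solves a quadratic equation. Its only root in the
  upper half plane is a stable one, so \<open>E s\<close> converges to it; it is the value at \<open>it\<close> of the Stieltjes
  transform of the semicircle law. The integrands are dominated by \<open>2 / (1 + t\<^sup>2)\<close>, and integrating the
  limit yields \<open>E energy X / n \<longlonglongrightarrow> 8 sqrt v / (3 pi)\<close> (\<open>expect_energy_tendsto\<close>).

  One concentration principle serves for the degrees, for \<open>s\<close> and for the energy: a function of the graph
  that changes little when one edge is flipped is close to its mean (\<open>bounded_differences_mgf\<close>).
\<close>

section \<open>The spectral theorem for real symmetric matrices\<close>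

text \<open>A complex eigenvalue exists by the fundamental theorem of algebra, and it is real because the form
  \<open>\<Sum> cnj (x i) * a i j * x j\<close> takes real values.\<close>

lemma real_symmetric_eigenvector:
  fixes a :: "nat \<Rightarrow> nat \<Rightarrow> real"
  assumes n: "0 < n" and sym: "\<And>i j. i < n \<Longrightarrow> j < n \<Longrightarrow> a i j = a j i"
  obtains c v where "(\<Sum>i<n. (v i)\<^sup>2) = 1" "\<And>i. i < n \<Longrightarrow> (\<Sum>j<n. a i j * v j) = c * v i"
proof -
  define A where "A = Matrix.mat n n (\<lambda>(i, j). complex_of_real (a i j))"
  have A: "A \<in> carrier_mat n n" by (simp add: A_def)
  obtain as where as: "char_poly A = (\<Prod>x\<leftarrow>as. [:- x, 1:])" "length as = n"
    using char_poly_factorized[OF A] by blast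
  then obtain z zs where "as = z # zs" using n by (cases as) auto
  hence "poly (char_poly A) z = 0" by (simp add: as)
  hence "eigenvalue A z" using eigenvalue_root_char_poly[OF A] by blast
  then obtain w where w: "w \<in> carrier_vec n" "w \<noteq> 0\<^sub>v n" "A *\<^sub>v w = z \<cdot>\<^sub>v w"
    using A unfolding eigenvalue_def eigenvector_def by auto
  define x where "x i = vec_index w i" for i
  have ev: "(\<Sum>j<n. complex_of_real (a i j) * x j) = z * x i" if "i < n" for i
  proof -
    have "vec_index (A *\<^sub>v w) i = vec_index (z \<cdot>\<^sub>v w) i" using w by simp
    thus ?thesis using that w A
      by (simp add: A_def scalar_prod_def x_def atLeast0LessThan)
  qed
  obtain i0 where i0: "i0 < n" "x i0 \<noteq> 0"
    using w unfolding x_def by (metis carrier_vecD dim_vec eq_vecI index_zero_vec(1) zero_carrier_vec)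
  define S where "S = (\<Sum>i<n. (cmod (x i))\<^sup>2)"
  have S: "S > 0" unfolding S_def
    by (rule sum_pos2[of _ i0]) (use i0 in auto)
  define T where "T = (\<Sum>i<n. cnj (x i) * (\<Sum>j<n. complex_of_real (a i j) * x j))"
  have T1: "T = z * of_real S"
  proof -
    have "T = (\<Sum>i<n. cnj (x i) * (z * x i))" unfolding T_def by (rule sum.cong) (auto simp: ev)
    also have "\<dots> = z * (\<Sum>i<n. of_real ((cmod (x i))\<^sup>2))"
      by (simp add: sum_distrib_left complex_norm_square mult_ac del: of_real_power)
    finally show ?thesis by (simp add: S_def)
  qed
  have "cnj T = (\<Sum>i<n. \<Sum>j<n. x i * (complex_of_real (a i j) * cnj (x j)))"
    by (simp add: T_def sum_distrib_left)
  also have "\<dots> = (\<Sum>j<n. \<Sum>i<n. x i * (complex_of_real (a i j) * cnj (x j)))"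
    by (rule sum.swap)
  also have "\<dots> = T" unfolding T_def sum_distrib_left
    by (intro sum.cong refl) (auto simp: sym mult_ac)
  finally have "Im T = 0" by (metis Reals_cnj_iff complex_is_Real_iff)
  hence zr: "Im z = 0" using S by (simp add: T1)
  \<comment> \<open>With a real eigenvalue, the real and the imaginary part of the eigenvector are both
    eigenvectors or zero.\<close>
  have re: "(\<Sum>j<n. a i j * Re (x j)) = Re z * Re (x i)" if "i < n" for i
    using arg_cong[OF ev[OF that], of Re] zr by simp
  have im: "(\<Sum>j<n. a i j * Im (x j)) = Re z * Im (x i)" if "i < n" for i
    using arg_cong[OF ev[OF that], of Im] zr by simp
  define y where "y i = (if Re (x i0) \<noteq> 0 then Re (x i) else Im (x i))" for i
  have y: "y i0 \<noteq> 0" "\<And>i. i < n \<Longrightarrow> (\<Sum>j<n. a i j * y j) = Re z * y i"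
    using i0 re im by (auto simp: y_def complex_eq_iff)
  define r where "r = sqrt (\<Sum>i<n. (y i)\<^sup>2)"
  have "(\<Sum>i<n. (y i)\<^sup>2) > 0" by (rule sum_pos2[of _ i0]) (use i0 y in auto)
  hence r: "r > 0" "r\<^sup>2 = (\<Sum>i<n. (y i)\<^sup>2)" by (auto simp: r_def)
  show ?thesis
  proof (rule that[of "\<lambda>i. y i / r" "Re z"])
    show "(\<Sum>i<n. (y i / r)\<^sup>2) = 1"
      using r(1) by (simp add: power_divide flip: sum_divide_distrib r(2))
    show "(\<Sum>j<n. a i j * (y j / r)) = Re z * (y i / r)" if "i < n" for i
      using y(2)[OF that] by (simp flip: sum_divide_distrib)
  qed
qed

text \<open>Real matrices of varying size are functions on pairs of indices, of which only those below \<open>n\<close> count.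
  The basis vectors are the rows of \<open>u\<close>. Recording the relations of the rows together with those of the
  columns keeps inverse matrices out of the sums.\<close>

definition orthonormal_basis :: "nat \<Rightarrow> (nat \<Rightarrow> nat \<Rightarrow> real) \<Rightarrow> bool" where
  "orthonormal_basis n u \<longleftrightarrow>
     (\<forall>k<n. \<forall>l<n. (\<Sum>i<n. u k i * u l i) = (if k = l then 1 else 0)) \<and>
     (\<forall>i<n. \<forall>j<n. (\<Sum>k<n. u k i * u k j) = (if i = j then 1 else 0))"

definition eigen_decomp ::
  "nat \<Rightarrow> (nat \<Rightarrow> nat \<Rightarrow> real) \<Rightarrow> (nat \<Rightarrow> real) \<Rightarrow> (nat \<Rightarrow> nat \<Rightarrow> real) \<Rightarrow> bool" where
  "eigen_decomp n a l u \<longleftrightarrow> orthonormal_basis n u \<and>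
     (\<forall>i<n. \<forall>j<n. a i j = (\<Sum>k<n. l k * (u k i * u k j)))"

lemma orthonormal_basisD:
  assumes "orthonormal_basis n u"
  shows "k < n \<Longrightarrow> l < n \<Longrightarrow> (\<Sum>i<n. u k i * u l i) = (if k = l then 1 else 0)"
    and "i < n \<Longrightarrow> j < n \<Longrightarrow> (\<Sum>k<n. u k i * u k j) = (if i = j then 1 else 0)"
  using assms unfolding orthonormal_basis_def by auto

text \<open>The reflection that swaps \<open>v\<close> with the last unit vector. It completes \<open>v\<close> to an orthonormal basis by an
  explicit formula, with \<open>v\<close> as the last column.\<close>

lemma householder:
  fixes v :: "nat \<Rightarrow> real"
  assumes v: "(\<Sum>i\<le>n. (v i)\<^sup>2) = 1"
  obtains h where "\<And>i j. h i j = h j i" "\<And>i. i \<le> n \<Longrightarrow> h i n = v i"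
    "\<And>i k. i \<le> n \<Longrightarrow> k \<le> n \<Longrightarrow> (\<Sum>j\<le>n. h i j * h j k) = (if i = k then 1 else 0 :: real)"
proof (cases "v n = 1")
  case True
  have "(\<Sum>i<n. (v i)\<^sup>2) = 0" using v True by (simp add: lessThan_Suc_atMost[symmetric])
  hence "\<forall>i<n. v i = 0" by (simp add: sum_nonneg_eq_0_iff)
  hence "v i = (if i = n then 1 else 0)" if "i \<le> n" for i using True that by auto
  moreover have "(\<Sum>j\<le>n. (if i = j then 1 else 0) * (if j = k then 1 else 0)) = (if i = k then 1 else 0 :: real)"
    if "i \<le> n" for i k
  proof -
    have "(\<Sum>j\<le>n. (if i = j then 1 else 0) * (if j = k then 1 else 0 :: real))
      = (\<Sum>j\<le>n. if i = j then if j = k then 1 else 0 else 0)" by (rule sum.cong) auto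
    thus ?thesis using that by simp
  qed
  ultimately show ?thesis by (intro that[of "\<lambda>i j. if i = j then 1 else 0"]) auto
next
  case False
  \<comment> \<open>The normal vector of the mirror, \<open>v\<close> minus the last unit vector; \<open>b\<close> is its squared length.\<close>
  define w where "w i = v i - (if i = n then 1 else 0)" for i
  define b where "b = 2 * (1 - v n)"
  have "(v n)\<^sup>2 \<le> (\<Sum>i\<le>n. (v i)\<^sup>2)" by (rule member_le_sum) auto
  hence "v n < 1" using v False by (metis abs_le_square_iff abs_le_D1 le_less one_power2 abs_one)
  hence b: "b > 0" by (simp add: b_def)
  have ww: "(\<Sum>i\<le>n. w i * w i) = b"
  proof -
    have "(\<Sum>i\<le>n. w i * w i) = (\<Sum>i\<le>n. (v i)\<^sup>2 + (if i = n then 1 - 2 * v i else 0))"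
      by (rule sum.cong) (auto simp: w_def power2_eq_square algebra_simps)
    also have "\<dots> = b" by (simp add: sum.distrib v b_def)
    finally show ?thesis .
  qed
  define c where "c = 2 / b"
  have cb: "c * b = 2" using b by (simp add: c_def)
  show ?thesis
  proof (rule that[of "\<lambda>i j. (if i = j then 1 else 0) - c * (w i * w j)"])
    show "(if i = j then 1 else 0) - c * (w i * w j) = (if j = i then 1 else 0) - c * (w j * w i)"
      for i j by auto
    have wn: "c * w n = -1" using b by (simp add: w_def b_def c_def field_simps)
    show "(if i = n then 1 else 0) - c * (w i * w n) = v i" for i
    proof -
      have "c * (w i * w n) = (c * w n) * w i" by simp
      thus ?thesis unfolding wn by (simp add: w_def)
    qed
    show "(\<Sum>j\<le>n. ((if i = j then 1 else 0) - c * (w i * w j)) * ((if j = k then 1 else 0) - c * (w j * w k)))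
       = (if i = k then 1 else 0)" if "i \<le> n" "k \<le> n" for i k
    proof -
      have "(\<Sum>j\<le>n. ((if i = j then 1 else 0) - c * (w i * w j)) * ((if j = k then 1 else 0) - c * (w j * w k)))
        = (\<Sum>j\<le>n. (if i = j then (if j = k then 1 else 0) - c * (w j * w k) else 0)
            - (if j = k then c * (w i * w j) else 0) + c * c * w i * w k * (w j * w j))"
        by (rule sum.cong) (auto simp: algebra_simps)
      also have "\<dots> = (if i = k then 1 else 0) - c * (w i * w k) - c * (w i * w k) + c * c * w i * w k * b"
        using that by (simp add: sum.distrib sum_subtractf ww flip: sum_distrib_left)
      also have "c * c * w i * w k * b = (c * b) * (c * (w i * w k))" by simp
      finally show ?thesis unfolding cb by simp
    qed
  qed
qed

lemma involution_matrix_cancel: 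
  fixes h :: "nat \<Rightarrow> nat \<Rightarrow> real"
  assumes "\<And>i k. i < N \<Longrightarrow> k < N \<Longrightarrow> (\<Sum>j<N. h i j * h j k) = (if i = k then 1 else 0)" 
    and "i < N"
  shows "(\<Sum>j<N. h i j * (\<Sum>m<N. h j m * g m)) = g i"
proof -
  have "(\<Sum>j<N. h i j * (\<Sum>m<N. h j m * g m)) = (\<Sum>j<N. \<Sum>m<N. h i j * h j m * g m)"
    by (simp add: sum_distrib_left mult_ac)
  also have "\<dots> = (\<Sum>m<N. (\<Sum>j<N. h i j * h j m) * g m)"
    by (subst sum.swap) (simp add: sum_distrib_right)
  also have "\<dots> = (\<Sum>m<N. if i = m then g m else 0)"
    by (rule sum.cong) (use assms in auto)
  also have "\<dots> = g i" using assms(2) by simp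
  finally show ?thesis .
qed

text \<open>Induction on the dimension. Conjugating with the Householder reflection of a unit eigenvector leaves a
  matrix whose last row and column vanish off the diagonal, and the hypothesis applies to the
  remaining block.\<close>

theorem spectral_theorem:
  fixes a :: "nat \<Rightarrow> nat \<Rightarrow> real"
  assumes "\<And>i j. i < n \<Longrightarrow> j < n \<Longrightarrow> a i j = a j i"
  shows "\<exists>l u. eigen_decomp n a l u"
  using assms
proof (induction n arbitrary: a)
  case 0
  show ?case by (auto simp: eigen_decomp_def orthonormal_basis_def)
next
  case (Suc n)
  define N where "N = Suc n"
  have lt: "i < N \<longleftrightarrow> i = n \<or> i < n" for i by (auto simp: N_def)
  have N_sum: "(\<Sum>i<N. g i) = (\<Sum>i<n. g i) + g n" for g :: "nat \<Rightarrow> real" by (simp add: N_def)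
  note sym = Suc.prems[folded N_def]
  obtain c v where v: "(\<Sum>i<N. (v i)\<^sup>2) = 1"
    and ev: "\<And>i. i < N \<Longrightarrow> (\<Sum>j<N. a i j * v j) = c * v i"
    by (rule real_symmetric_eigenvector[of N a, OF _ sym]; (simp add: N_def; fail | assumption | rule that))
  obtain h where hs: "\<And>i j. h i j = h j i" and hn: "\<And>i. i < N \<Longrightarrow> h i n = v i"
    and hh: "\<And>i k. i < N \<Longrightarrow> k < N \<Longrightarrow> (\<Sum>j<N. h i j * h j k) = (if i = k then 1 else 0 :: real)"
    by (rule householder[of v n, folded lessThan_Suc_atMost less_Suc_eq_le N_def, OF v]; (assumption | rule that; assumption))
  define b where "b i j = (\<Sum>x<N. h i x * (\<Sum>y<N. a x y * h y j))" for i j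
  have b_sym: "b i j = b j i" for i j
  proof -
    have "b i j = (\<Sum>x<N. \<Sum>y<N. h i x * a x y * h y j)"
      by (simp add: b_def sum_distrib_left mult_ac)
    also have "\<dots> = (\<Sum>y<N. \<Sum>x<N. h i x * a x y * h y j)" by (rule sum.swap)
    also have "\<dots> = b j i" unfolding b_def sum_distrib_left
      by (intro sum.cong refl) (auto simp: sym hs mult_ac)
    finally show ?thesis .
  qed
  have bn: "b i n = (if i = n then c else 0)" if "i < N" for i
  proof -
    have "(\<Sum>y<N. a x y * h y n) = c * v x" if "x < N" for x
    proof -
      have "(\<Sum>y<N. a x y * h y n) = (\<Sum>y<N. a x y * v y)"
        by (rule sum.cong) (simp_all add: hn)
      thus ?thesis using ev[OF that] by simp
    qed
    hence "b i n = (\<Sum>x<N. h i x * (c * v x))" unfolding b_def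
      by (intro sum.cong refl) simp
    also have "\<dots> = c * (\<Sum>x<N. h i x * h x n)" unfolding sum_distrib_left
      by (rule sum.cong) (simp_all add: hn)
    finally show ?thesis using hh[of i n] that by (simp add: lt)
  qed
  obtain l u where lu: "eigen_decomp n b l u" using Suc.IH[of b] b_sym by blast
  have ob: "orthonormal_basis n u" using lu by (simp add: eigen_decomp_def)
  define u' where "u' k i = (if k = n \<or> i = n then (if k = i then 1 else 0) else u k i)" for k i
  define l' where "l' = l(n := c)"
  have ob': "orthonormal_basis N u'"
    unfolding orthonormal_basis_def
    using orthonormal_basisD[OF ob] by (auto simp: u'_def lt N_sum)
  have b_eq: "b i j = (\<Sum>k<N. l' k * (u' k i * u' k j))" if "i < N" "j < N" for i j
  proof (cases "i = n \<or> j = n")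
    case True
    thus ?thesis using bn[of i] bn[of j] b_sym that by (auto simp: u'_def l'_def N_sum lt)
  next
    case False
    hence "b i j = (\<Sum>k<n. l k * (u k i * u k j))" using lu that by (auto simp: eigen_decomp_def lt)
    thus ?thesis using False by (simp add: u'_def l'_def N_sum)
  qed
  define U where "U k i = (\<Sum>x<N. h i x * u' k x)" for k i
  have a_eq: "a i j = (\<Sum>k<N. l' k * (U k i * U k j))" if ij: "i < N" "j < N" for i j
  proof -
    have "(\<Sum>k<N. l' k * (U k i * U k j)) = (\<Sum>k<N. \<Sum>x<N. \<Sum>y<N. h i x * (h j y * (l' k * (u' k x * u' k y))))"
      unfolding U_def sum_product by (simp add: sum_distrib_left mult_ac)
    also have "\<dots> = (\<Sum>x<N. \<Sum>y<N. \<Sum>k<N. h i x * (h j y * (l' k * (u' k x * u' k y))))"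
      by (subst sum.swap) (rule sum.cong[OF refl], rule sum.swap)
    also have "\<dots> = (\<Sum>x<N. \<Sum>y<N. h i x * (h j y * b x y))"
      by (intro sum.cong refl) (use b_eq in \<open>auto simp: sum_distrib_left\<close>)
    also have "\<dots> = (\<Sum>x<N. h i x * (\<Sum>y<N. h j y * b y x))"
      by (simp add: sum_distrib_left b_sym mult_ac)
    also have "\<dots> = (\<Sum>x<N. h i x * (\<Sum>m<N. a j m * h m x))"
      unfolding b_def by (intro sum.cong refl arg_cong2[of _ _ _ _ times] involution_matrix_cancel hh) (use ij in auto)
    also have "\<dots> = (\<Sum>x<N. h i x * (\<Sum>m<N. h x m * a m j))"
      unfolding sum_distrib_left by (intro sum.cong refl) (use ij in \<open>auto simp: sym hs mult_ac\<close>)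
    also have "\<dots> = a i j" by (rule involution_matrix_cancel[OF hh]) (use ij in auto)
    finally show ?thesis by simp
  qed
  have "orthonormal_basis N U" unfolding orthonormal_basis_def
  proof (intro conjI allI impI)
    fix k m assume km: "k < N" "m < N"
    have "(\<Sum>i<N. U k i * U m i) = (\<Sum>i<N. \<Sum>x<N. (h i x * u' k x) * (\<Sum>y<N. h i y * u' m y))"
      by (simp only: U_def sum_distrib_right)
    also have "\<dots> = (\<Sum>x<N. \<Sum>i<N. (h i x * u' k x) * (\<Sum>y<N. h i y * u' m y))" by (rule sum.swap)
    also have "\<dots> = (\<Sum>x<N. u' k x * (\<Sum>i<N. h x i * (\<Sum>y<N. h i y * u' m y)))"
      by (intro sum.cong refl) (simp add: sum_distrib_left hs mult_ac)
    also have "\<dots> = (\<Sum>x<N. u' k x * u' m x)"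
      by (intro sum.cong refl arg_cong2[of _ _ _ _ times] involution_matrix_cancel hh) auto
    finally show "(\<Sum>i<N. U k i * U m i) = (if k = m then 1 else 0)"
      using orthonormal_basisD(1)[OF ob' km] by simp
  next
    fix i j assume ij: "i < N" "j < N"
    have "(\<Sum>k<N. U k i * U k j) = (\<Sum>k<N. \<Sum>x<N. \<Sum>y<N. h i x * (h j y * (u' k x * u' k y)))"
      unfolding U_def sum_product by (simp add: mult_ac)
    also have "\<dots> = (\<Sum>x<N. \<Sum>y<N. \<Sum>k<N. h i x * (h j y * (u' k x * u' k y)))"
      by (subst sum.swap) (rule sum.cong[OF refl], rule sum.swap)
    also have "\<dots> = (\<Sum>x<N. \<Sum>y<N. h i x * (h j y * (\<Sum>k<N. u' k x * u' k y)))"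
      by (simp add: sum_distrib_left)
    also have "\<dots> = (\<Sum>x<N. \<Sum>y<N. if x = y then h i x * h j y else 0)"
      by (intro sum.cong refl) (use orthonormal_basisD(2)[OF ob'] in auto)
    also have "\<dots> = (\<Sum>x<N. h i x * h x j)"
      by (intro sum.cong refl) (subst sum.delta', auto simp: hs)
    finally show "(\<Sum>k<N. U k i * U k j) = (if i = j then 1 else 0)" using hh[OF ij] by simp
  qed
  with a_eq show ?case unfolding eigen_decomp_def N_def[symmetric] by blast
qed

lemma order_prod_linear:
  "finite K \<Longrightarrow> Polynomial.order x (\<Prod>k\<in>K. [:- l k, 1:]) = card {k\<in>K. l k = (x::real)}"
proof (induction K rule: finite_induct)
  case empty
  show ?case by (simp add: order_0I)
next
  case (insert k K)
  have "(\<Prod>k\<in>K. [:- l k, 1:]) \<noteq> 0" using insert by simp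
  hence nz: "[:- l k, 1:] * (\<Prod>k\<in>K. [:- l k, 1:]) \<noteq> 0" by (metis mult_eq_0_iff one_neq_zero pCons_eq_0_iff)
  have o: "Polynomial.order x [:- l k, 1:] = (if l k = x then 1 else 0)"
    using order_power_n_n[of x 1] by (auto intro: order_0I)
  have "{j \<in> insert k K. l j = x} = (if l k = x then insert k {j\<in>K. l j = x} else {j\<in>K. l j = x})" by auto
  hence "card {j \<in> insert k K. l j = x} = (if l k = x then 1 else 0) + card {j\<in>K. l j = x}"
    using insert.hyps by simp
  thus ?case by (simp only: prod.insert[OF insert.hyps] order_mult[OF nz] o insert.IH)
qed

text \<open>Any orthonormal diagonalisation computes the energy, since similar matrices have the same
  characteristic polynomial, here a product of linear factors.\<close>

theorem energy_eigen_decomp: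
  assumes "eigen_decomp n a l u"
  shows "energy (Matrix.mat n n (\<lambda>(i, j). a i j)) = (\<Sum>k<n. \<bar>l k\<bar>)"
proof -
  let ?A = "Matrix.mat n n (\<lambda>(i, j). a i j)"
  let ?D = "Matrix.mat n n (\<lambda>(i, j). if i = j then l i else 0)"
  let ?P = "Matrix.mat n n (\<lambda>(i, k). u k i)"
  let ?Q = "Matrix.mat n n (\<lambda>(k, i). u k i)"
  have ob: "orthonormal_basis n u" using assms by (simp add: eigen_decomp_def)
  have c: "?A \<in> carrier_mat n n" "?D \<in> carrier_mat n n" "?P \<in> carrier_mat n n" "?Q \<in> carrier_mat n n" by auto
  have PQ: "?P * ?Q = 1\<^sub>m n" "?Q * ?P = 1\<^sub>m n"
    by (rule eq_matI; use orthonormal_basisD[OF ob] in \<open>simp add: scalar_prod_def atLeast0LessThan\<close>)+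
  have DQ: "?P * ?D = Matrix.mat n n (\<lambda>(i, k). l k * u k i)"
    by (rule eq_matI) (simp_all add: scalar_prod_def atLeast0LessThan if_distrib sum.delta' cong: if_cong)
  have "?A = ?P * ?D * ?Q" unfolding DQ
    by (rule eq_matI) (use assms in \<open>simp_all add: scalar_prod_def atLeast0LessThan eigen_decomp_def mult_ac\<close>)
  with PQ c have "similar_mat_wit ?A ?D ?P ?Q" unfolding similar_mat_wit_def Let_def by auto
  hence "char_poly ?A = char_poly ?D" using char_poly_similar unfolding similar_mat_def by blast
  also have "\<dots> = (\<Prod>a\<leftarrow>diag_mat ?D. [:- a, 1:])"
    by (rule char_poly_upper_triangular[OF c(2)]) (auto simp: upper_triangular_def)
  also have "diag_mat ?D = map l [0..<n]" by (auto simp: diag_mat_def)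
  also have "(\<Prod>a\<leftarrow>map l [0..<n]. [:- a, 1:]) = (\<Prod>k\<in>{..<n}. [:- l k, 1:])"
    by (simp add: prod.distinct_set_conv_list[symmetric] o_def atLeast0LessThan)
  finally have cp: "char_poly ?A = (\<Prod>k\<in>{..<n}. [:- l k, 1:])" .
  have "{x. eigenvalue ?A x} = l ` {..<n}"
    unfolding eigenvalue_root_char_poly[OF c(1)] cp by (auto simp: poly_prod)
  hence "energy ?A = (\<Sum>x\<in>l ` {..<n}. real (card {k\<in>{..<n}. l k = x}) * \<bar>x\<bar>)"
    unfolding energy_def cp by (simp add: order_prod_linear)
  also have "\<dots> = (\<Sum>x\<in>l ` {..<n}. \<Sum>k\<in>{k\<in>{..<n}. l k = x}. \<bar>l k\<bar>)" by simp
  also have "\<dots> = (\<Sum>k<n. \<bar>l k\<bar>)" by (rule sum.image_gen[symmetric]) simp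
  finally show ?thesis .
qed

section \<open>Energy as a trace norm\<close>

abbreviation energy_of :: "nat \<Rightarrow> (nat \<Rightarrow> nat \<Rightarrow> real) \<Rightarrow> real" where
  "energy_of n a \<equiv> energy (Matrix.mat n n (\<lambda>(i, j). a i j))"

definition quad_form :: "nat \<Rightarrow> (nat \<Rightarrow> nat \<Rightarrow> real) \<Rightarrow> (nat \<Rightarrow> real) \<Rightarrow> real" where
  "quad_form n c x = (\<Sum>i<n. \<Sum>j<n. x i * c i j * x j)"

lemma eigen_decomp_quad_form:
  assumes "eigen_decomp n a l u"
  shows "quad_form n a x = (\<Sum>k<n. l k * (\<Sum>i<n. u k i * x i)\<^sup>2)"
proof -
  have "quad_form n a x = (\<Sum>i<n. \<Sum>j<n. \<Sum>k<n. l k * ((u k i * x i) * (u k j * x j)))"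
    unfolding quad_form_def
  proof (intro sum.cong refl)
    fix i j assume "i \<in> {..<n}" "j \<in> {..<n}"
    hence "a i j = (\<Sum>k<n. l k * (u k i * u k j))" using assms by (simp add: eigen_decomp_def)
    thus "x i * a i j * x j = (\<Sum>k<n. l k * ((u k i * x i) * (u k j * x j)))"
      by (simp add: sum_distrib_left sum_distrib_right mult_ac)
  qed
  also have "\<dots> = (\<Sum>i<n. \<Sum>k<n. \<Sum>j<n. l k * ((u k i * x i) * (u k j * x j)))"
    by (intro sum.cong refl sum.swap)
  also have "\<dots> = (\<Sum>k<n. \<Sum>i<n. \<Sum>j<n. l k * ((u k i * x i) * (u k j * x j)))"
    by (rule sum.swap)
  also have "\<dots> = (\<Sum>k<n. l k * (\<Sum>i<n. u k i * x i)\<^sup>2)"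
    unfolding power2_eq_square sum_product by (simp add: sum_distrib_left)
  finally show ?thesis .
qed

lemma parseval:
  assumes "orthonormal_basis n u"
  shows "(\<Sum>k<n. (\<Sum>i<n. u k i * x i)\<^sup>2) = (\<Sum>i<n. (x i)\<^sup>2)"
proof -
  have "(\<Sum>k<n. (\<Sum>i<n. u k i * x i)\<^sup>2) = (\<Sum>k<n. \<Sum>i<n. \<Sum>j<n. (u k i * u k j) * (x i * x j))"
    unfolding power2_eq_square sum_product by (simp add: mult_ac)
  also have "\<dots> = (\<Sum>i<n. \<Sum>k<n. \<Sum>j<n. (u k i * u k j) * (x i * x j))" by (rule sum.swap)
  also have "\<dots> = (\<Sum>i<n. \<Sum>j<n. \<Sum>k<n. (u k i * u k j) * (x i * x j))"
    by (intro sum.cong refl sum.swap)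
  also have "\<dots> = (\<Sum>i<n. \<Sum>j<n. (if i = j then 1 else 0) * (x i * x j))"
    using orthonormal_basisD(2)[OF assms] by (intro sum.cong refl) (simp flip: sum_distrib_right)
  also have "\<dots> = (\<Sum>i<n. \<Sum>j<n. if i = j then x i * x j else 0)"
    by (intro sum.cong refl) auto
  finally show ?thesis by (simp add: power2_eq_square)
qed

text \<open>The trace norm dominates the absolute diagonal sum in every orthonormal basis: the squared
  inner products of two orthonormal bases form a doubly stochastic matrix.\<close>

lemma sum_abs_quad_form_le_energy:
  assumes u: "orthonormal_basis n u" and b: "\<And>i j. i < n \<Longrightarrow> j < n \<Longrightarrow> b i j = b j i"
  shows "(\<Sum>k<n. \<bar>quad_form n b (u k)\<bar>) \<le> energy_of n b"
proof -
  obtain m w where mw: "eigen_decomp n b m w" using spectral_theorem[of n b] b by blast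
  hence w: "orthonormal_basis n w" by (simp add: eigen_decomp_def)
  have "(\<Sum>k<n. \<bar>quad_form n b (u k)\<bar>) \<le> (\<Sum>k<n. \<Sum>r<n. \<bar>m r\<bar> * (\<Sum>i<n. w r i * u k i)\<^sup>2)"
    unfolding eigen_decomp_quad_form[OF mw]
    by (intro sum_mono order_trans[OF sum_abs]) (simp add: abs_mult)
  also have "\<dots> = (\<Sum>r<n. \<bar>m r\<bar> * (\<Sum>k<n. (\<Sum>i<n. u k i * w r i)\<^sup>2))"
    by (subst sum.swap) (simp add: sum_distrib_left mult_ac)
  also have "\<dots> = (\<Sum>r<n. \<bar>m r\<bar>)"
    unfolding parseval[OF u] using orthonormal_basisD(1)[OF w] by (simp add: power2_eq_square)
  finally show ?thesis by (simp add: energy_eigen_decomp[OF mw])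
qed

text \<open>In an eigenbasis of \<open>a\<close> the diagonal of \<open>a\<close> has absolute sum exactly \<open>energy a\<close>, while the
  diagonal of \<open>b\<close> has at most \<open>energy b\<close>. So a bound on the diagonal of \<open>a - b\<close> that is uniform over
  all orthonormal bases is a perturbation bound for the energy.\<close>

lemma energy_le_add:
  assumes a: "\<And>i j. i < n \<Longrightarrow> j < n \<Longrightarrow> a i j = a j i"
    and b: "\<And>i j. i < n \<Longrightarrow> j < n \<Longrightarrow> b i j = b j i"
    and M: "\<And>u. orthonormal_basis n u \<Longrightarrow> (\<Sum>k<n. \<bar>quad_form n (\<lambda>i j. a i j - b i j) (u k)\<bar>) \<le> M"
  shows "energy_of n a \<le> energy_of n b + M"
proof -
  obtain l u where lu: "eigen_decomp n a l u" using spectral_theorem[of n a] a by blast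
  hence u: "orthonormal_basis n u" by (simp add: eigen_decomp_def)
  have l: "l k = quad_form n a (u k)" if "k < n" for k
  proof -
    have "quad_form n a (u k) = (\<Sum>r<n. if r = k then l r else 0)"
      unfolding eigen_decomp_quad_form[OF lu] using orthonormal_basisD(1)[OF u _ that] 
      by (intro sum.cong) auto
    thus ?thesis using that by simp
  qed
  have "quad_form n a x = quad_form n b x + quad_form n (\<lambda>i j. a i j - b i j) x" for x
    unfolding quad_form_def by (simp add: algebra_simps flip: sum.distrib)
  hence "(\<Sum>k<n. \<bar>l k\<bar>) \<le> (\<Sum>k<n. \<bar>quad_form n b (u k)\<bar> + \<bar>quad_form n (\<lambda>i j. a i j - b i j) (u k)\<bar>)"
    by (intro sum_mono) (simp add: l)
  also have "\<dots> \<le> energy_of n b + M"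
    unfolding sum.distrib by (intro add_mono sum_abs_quad_form_le_energy u b M)
  finally show ?thesis by (simp add: energy_eigen_decomp[OF lu])
qed

lemma energy_diff_le:
  assumes a: "\<And>i j. i < n \<Longrightarrow> j < n \<Longrightarrow> a i j = a j i"
    and b: "\<And>i j. i < n \<Longrightarrow> j < n \<Longrightarrow> b i j = b j i"
    and M: "\<And>u. orthonormal_basis n u \<Longrightarrow> (\<Sum>k<n. \<bar>quad_form n (\<lambda>i j. a i j - b i j) (u k)\<bar>) \<le> M"
  shows "\<bar>energy_of n a - energy_of n b\<bar> \<le> M"
proof -
  have "quad_form n (\<lambda>i j. b i j - a i j) x = - quad_form n (\<lambda>i j. a i j - b i j) x" for x
    unfolding quad_form_def by (simp add: algebra_simps flip: sum_negf)
  hence "energy_of n b \<le> energy_of n a + M"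
    using M by (intro energy_le_add a b) auto
  moreover have "energy_of n a \<le> energy_of n b + M" by (intro energy_le_add a b M)
  ultimately show ?thesis by linarith
qed

text \<open>Two applications of the Cauchy--Schwarz inequality: the trace norm is at most \<open>sqrt n\<close> times the
  Frobenius norm, which is at most \<open>n * \<eta>\<close>.\<close>

lemma energy_diff_le_entrywise:
  assumes a: "\<And>i j. i < n \<Longrightarrow> j < n \<Longrightarrow> a i j = a j i"
    and b: "\<And>i j. i < n \<Longrightarrow> j < n \<Longrightarrow> b i j = b j i"
    and \<eta>: "\<And>i j. i < n \<Longrightarrow> j < n \<Longrightarrow> \<bar>a i j - b i j\<bar> \<le> \<eta>" "0 \<le> \<eta>"
  shows "\<bar>energy_of n a - energy_of n b\<bar> \<le> real n * sqrt (real n) * \<eta>"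
proof (rule energy_diff_le[OF a b])
  fix u assume u: "orthonormal_basis n u"
  define c where "c i j = a i j - b i j" for i j
  define q where "q k = quad_form n c (u k)" for k
  have q: "(q k)\<^sup>2 \<le> (\<Sum>i<n. (\<Sum>j<n. u k j * c i j)\<^sup>2)" if "k < n" for k
  proof -
    have "q k = (\<Sum>i<n. u k i * (\<Sum>j<n. u k j * c i j))"
      by (simp add: q_def quad_form_def sum_distrib_left mult_ac)
    hence "(q k)\<^sup>2 \<le> (\<Sum>i<n. (u k i)\<^sup>2) * (\<Sum>i<n. (\<Sum>j<n. u k j * c i j)\<^sup>2)"
      using Cauchy_Schwarz_ineq_sum by metis
    thus ?thesis using orthonormal_basisD(1)[OF u that that] by (simp add: power2_eq_square)
  qed
  have "(\<Sum>k<n. (q k)\<^sup>2) \<le> (\<Sum>k<n. \<Sum>i<n. (\<Sum>j<n. u k j * c i j)\<^sup>2)"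
    by (intro sum_mono q) simp
  also have "\<dots> = (\<Sum>i<n. \<Sum>j<n. (c i j)\<^sup>2)"
    by (subst sum.swap) (simp add: parseval[OF u])
  also have "\<dots> \<le> (\<Sum>i<n. \<Sum>j<n. \<eta>\<^sup>2)"
    using \<eta> by (intro sum_mono) (simp add: c_def abs_le_square_iff[symmetric])
  also have "\<dots> = (real n * \<eta>)\<^sup>2" by (simp add: power2_eq_square)
  finally have qq: "(\<Sum>k<n. (q k)\<^sup>2) \<le> (real n * \<eta>)\<^sup>2" .
  have "(\<Sum>k<n. \<bar>q k\<bar>)\<^sup>2 \<le> (\<Sum>k<n. (1::real)\<^sup>2) * (\<Sum>k<n. \<bar>q k\<bar>\<^sup>2)"
    using Cauchy_Schwarz_ineq_sum[of "\<lambda>_. 1" "\<lambda>k. \<bar>q k\<bar>" "{..<n}"] by simp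
  also have "\<dots> \<le> real n * (real n * \<eta>)\<^sup>2" using qq by (simp add: mult_left_mono)
  also have "\<dots> = (real n * sqrt (real n) * \<eta>)\<^sup>2" by (simp add: power_mult_distrib)
  finally have "(\<Sum>k<n. \<bar>q k\<bar>) \<le> real n * sqrt (real n) * \<eta>"
    using \<eta>(2) by (auto intro: power2_le_imp_le)
  thus "(\<Sum>k<n. \<bar>quad_form n (\<lambda>i j. a i j - b i j) (u k)\<bar>) \<le> real n * sqrt (real n) * \<eta>"
    by (simp add: q_def c_def[abs_def])
qed

text \<open>The matrix with all entries \<open>c\<close> has rank one, and its trace norm is only \<open>n * \<bar>c\<bar>\<close>; the entrywise
  bound would be too weak by a factor of order \<open>sqrt n\<close>. The second \<open>n * \<bar>c\<bar>\<close> pays for the diagonal.\<close>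

lemma energy_diff_le_offdiag_const:
  assumes a: "\<And>i j. i < n \<Longrightarrow> j < n \<Longrightarrow> a i j = a j i"
    and b: "\<And>i j. i < n \<Longrightarrow> j < n \<Longrightarrow> b i j = b j i"
    and c: "\<And>i j. i < n \<Longrightarrow> j < n \<Longrightarrow> a i j - b i j = (if i = j then 0 else c)"
  shows "\<bar>energy_of n a - energy_of n b\<bar> \<le> 2 * real n * \<bar>c\<bar>"
proof (rule energy_diff_le[OF a b])
  fix u assume u: "orthonormal_basis n u"
  have q: "quad_form n (\<lambda>i j. a i j - b i j) (u k) = c * (\<Sum>i<n. u k i * 1)\<^sup>2 - c" if "k < n" for k
  proof -
    have "quad_form n (\<lambda>i j. a i j - b i j) (u k) =
       (\<Sum>i<n. \<Sum>j<n. c * (u k i * u k j) - (if i = j then c * (u k i * u k j) else 0))"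
      unfolding quad_form_def by (intro sum.cong refl) (simp add: c)
    also have "\<dots> = c * (\<Sum>i<n. \<Sum>j<n. u k i * u k j) - c * (\<Sum>i<n. u k i * u k i)"
      by (simp add: sum_subtractf sum_distrib_left)
    also have "(\<Sum>i<n. u k i * u k i) = 1" using orthonormal_basisD(1)[OF u that that] by simp
    finally show ?thesis by (simp add: power2_eq_square sum_product)
  qed
  have "(\<Sum>k<n. \<bar>quad_form n (\<lambda>i j. a i j - b i j) (u k)\<bar>) \<le> (\<Sum>k<n. \<bar>c\<bar> * (\<Sum>i<n. u k i * 1)\<^sup>2 + \<bar>c\<bar>)"
    by (intro sum_mono) (simp add: q abs_mult order_trans[OF abs_triangle_ineq4])
  also have "\<dots> = \<bar>c\<bar> * (\<Sum>k<n. (\<Sum>i<n. u k i * 1)\<^sup>2) + real n * \<bar>c\<bar>"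
    by (simp add: sum.distrib sum_distrib_left)
  also have "\<dots> = 2 * real n * \<bar>c\<bar>" unfolding parseval[OF u] by simp
  finally show "(\<Sum>k<n. \<bar>quad_form n (\<lambda>i j. a i j - b i j) (u k)\<bar>) \<le> 2 * real n * \<bar>c\<bar>" .
qed

text \<open>The direction in which a symmetric matrix moves when the edge between \<open>x\<close> and \<open>y\<close> is flipped.\<close>

definition sym_unit :: "nat \<Rightarrow> nat \<Rightarrow> nat \<Rightarrow> nat \<Rightarrow> real" where
  "sym_unit x y i j = (if i = x \<and> j = y \<or> i = y \<and> j = x then 1 else 0)"

lemma sum_sym_unit:
  fixes f :: "nat \<Rightarrow> nat \<Rightarrow> 'b :: real_normed_vector"
  assumes "x < n" "y < n" "x \<noteq> y"
  shows "(\<Sum>i<n. \<Sum>j<n. sym_unit x y i j *\<^sub>R f i j) = f x y + f y x"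
proof -
  have "(\<Sum>i<n. \<Sum>j<n. sym_unit x y i j *\<^sub>R f i j) =
     (\<Sum>i<n. \<Sum>j<n. (if i = x then if j = y then f i j else 0 else 0) + (if i = y then if j = x then f i j else 0 else 0))"
    using assms by (intro sum.cong refl) (auto simp: sym_unit_def)
  also have "\<dots> = (\<Sum>i<n. (if i = x then f i y else 0) + (if i = y then f i x else 0))"
  proof (intro sum.cong refl)
    fix i
    show "(\<Sum>j<n. (if i = x then if j = y then f i j else 0 else 0) + (if i = y then if j = x then f i j else 0 else 0))
      = (if i = x then f i y else 0) + (if i = y then f i x else 0)"
      using assms by (cases "i = x"; cases "i = y") (simp_all add: sum.distrib)
  qed
  finally show ?thesis using assms by (simp add: sum.distrib)
qed

lemma energy_diff_le_sym_unit:
  assumes a: "\<And>i j. i < n \<Longrightarrow> j < n \<Longrightarrow> a i j = a j i"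
    and b: "\<And>i j. i < n \<Longrightarrow> j < n \<Longrightarrow> b i j = b j i"
    and xy: "x < n" "y < n" "x \<noteq> y"
    and d: "\<And>i j. i < n \<Longrightarrow> j < n \<Longrightarrow> a i j - b i j = d * sym_unit x y i j"
  shows "\<bar>energy_of n a - energy_of n b\<bar> \<le> 2 * \<bar>d\<bar>"
proof (rule energy_diff_le[OF a b])
  fix u assume u: "orthonormal_basis n u"
  have q: "quad_form n (\<lambda>i j. a i j - b i j) z = 2 * d * (z x * z y)" for z
  proof -
    have "quad_form n (\<lambda>i j. a i j - b i j) z = (\<Sum>i<n. \<Sum>j<n. sym_unit x y i j *\<^sub>R (d * (z i * z j)))"
      unfolding quad_form_def by (intro sum.cong refl) (simp add: d)
    thus ?thesis using sum_sym_unit[OF xy, of "\<lambda>i j. d * (z i * z j)"] by simp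
  qed
  have "(\<Sum>k<n. \<bar>quad_form n (\<lambda>i j. a i j - b i j) (u k)\<bar>) \<le> (\<Sum>k<n. \<bar>d\<bar> * (u k x * u k x + u k y * u k y))"
  proof (rule sum_mono)
    fix k
    have "0 \<le> (\<bar>u k x\<bar> - \<bar>u k y\<bar>)\<^sup>2" by simp
    hence "2 * \<bar>u k x * u k y\<bar> \<le> (u k x)\<^sup>2 + (u k y)\<^sup>2"
      by (simp add: power2_diff abs_mult)
    hence "2 * \<bar>u k x * u k y\<bar> \<le> u k x * u k x + u k y * u k y"
      by (simp only: power2_eq_square)
    thus "\<bar>quad_form n (\<lambda>i j. a i j - b i j) (u k)\<bar> \<le> \<bar>d\<bar> * (u k x * u k x + u k y * u k y)"
      using mult_left_mono[of _ _ "\<bar>d\<bar>"] by (fastforce simp: q abs_mult)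
  qed
  also have "\<dots> = \<bar>d\<bar> * ((\<Sum>k<n. u k x * u k x) + (\<Sum>k<n. u k y * u k y))"
    by (simp add: sum.distrib flip: sum_distrib_left)
  also have "\<dots> = 2 * \<bar>d\<bar>" using orthonormal_basisD(2)[OF u] xy by simp
  finally show "(\<Sum>k<n. \<bar>quad_form n (\<lambda>i j. a i j - b i j) (u k)\<bar>) \<le> 2 * \<bar>d\<bar>" .
qed

lemma energy_scale:
  assumes a: "\<And>i j. i < n \<Longrightarrow> j < n \<Longrightarrow> a i j = a j i"
  shows "energy_of n (\<lambda>i j. c * a i j) = \<bar>c\<bar> * energy_of n a"
proof -
  obtain l u where lu: "eigen_decomp n a l u" using spectral_theorem[of n a] a by blast
  hence "eigen_decomp n (\<lambda>i j. c * a i j) (\<lambda>k. c * l k) u"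
    by (simp add: eigen_decomp_def sum_distrib_left mult_ac)
  thus ?thesis using energy_eigen_decomp[OF lu] energy_eigen_decomp
    by (simp add: abs_mult sum_distrib_left)
qed

lemma sum_eigenvalues_squared:
  assumes lu: "eigen_decomp n a l u"
  shows "(\<Sum>k<n. (l k)\<^sup>2) = (\<Sum>i<n. \<Sum>j<n. (a i j)\<^sup>2)"
proof -
  have u: "orthonormal_basis n u" using lu by (simp add: eigen_decomp_def)
  have "(\<Sum>j<n. (a i j)\<^sup>2) = (\<Sum>k<n. (l k * u k i)\<^sup>2)" if "i < n" for i
  proof -
    have eq: "(\<Sum>j<n. u k j * a i j) = l k * u k i" if "k < n" for k
    proof -
      have "(\<Sum>j<n. u k j * a i j) = (\<Sum>j<n. \<Sum>r<n. l r * u r i * (u k j * u r j))"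
        using lu \<open>i < n\<close> by (simp add: eigen_decomp_def sum_distrib_left mult_ac)
      also have "\<dots> = (\<Sum>r<n. l r * u r i * (\<Sum>j<n. u k j * u r j))"
        by (subst sum.swap) (simp add: sum_distrib_left)
      also have "\<dots> = (\<Sum>r<n. if r = k then l r * u r i else 0)"
        using orthonormal_basisD(1)[OF u that] by (intro sum.cong) auto
      finally show ?thesis using that by simp
    qed
    have "(\<Sum>j<n. (a i j)\<^sup>2) = (\<Sum>k<n. (\<Sum>j<n. u k j * a i j)\<^sup>2)" by (rule parseval[OF u, symmetric])
    thus ?thesis by (simp add: eq)
  qed
  hence "(\<Sum>i<n. \<Sum>j<n. (a i j)\<^sup>2) = (\<Sum>k<n. (l k)\<^sup>2 * (\<Sum>i<n. u k i * u k i))"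
    by (simp, subst sum.swap) (simp add: power2_eq_square sum_distrib_left mult_ac)
  thus ?thesis using orthonormal_basisD(1)[OF u] by simp
qed

section \<open>Resolvents on the imaginary axis\<close>

text \<open>An eigendecomposition is fixed by choice, so that the resolvent becomes a function of the matrix alone.\<close>

definition eigvals :: "nat \<Rightarrow> (nat \<Rightarrow> nat \<Rightarrow> real) \<Rightarrow> nat \<Rightarrow> real" where
  "eigvals n a = (SOME l. \<exists>u. eigen_decomp n a l u)"

definition eigvecs :: "nat \<Rightarrow> (nat \<Rightarrow> nat \<Rightarrow> real) \<Rightarrow> nat \<Rightarrow> nat \<Rightarrow> real" where
  "eigvecs n a = (SOME u. eigen_decomp n a (eigvals n a) u)"

lemma eigen_decomp_eigvals:
  assumes "\<And>i j. i < n \<Longrightarrow> j < n \<Longrightarrow> a i j = a j i"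
  shows "eigen_decomp n a (eigvals n a) (eigvecs n a)"
proof -
  have "\<exists>l u. eigen_decomp n a l u" by (rule spectral_theorem) (rule assms)
  hence "\<exists>u. eigen_decomp n a (eigvals n a) u" unfolding eigvals_def by (rule someI_ex)
  thus ?thesis unfolding eigvecs_def by (rule someI_ex)
qed

text \<open>This is \<open>(A - it)\<^sup>-\<^sup>1\<close>, written in the chosen eigenbasis; \<open>Complex l (- t)\<close> is \<open>l - it\<close>.\<close>

definition resolvent :: "nat \<Rightarrow> real \<Rightarrow> (nat \<Rightarrow> nat \<Rightarrow> real) \<Rightarrow> nat \<Rightarrow> nat \<Rightarrow> complex" where
  "resolvent n t a i j =
     (\<Sum>k<n. of_real (eigvecs n a k j) * (of_real (eigvecs n a k i) / Complex (eigvals n a k) (- t)))"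

lemma resolvent_sym: "resolvent n t a i j = resolvent n t a j i"
  by (simp add: resolvent_def mult_ac)

lemma orthonormal_basis_transpose:
  "orthonormal_basis n u \<Longrightarrow> orthonormal_basis n (\<lambda>i k. u k i)"
  by (simp add: orthonormal_basis_def)

context
  fixes n :: nat and a :: "nat \<Rightarrow> nat \<Rightarrow> real" and t :: real
  assumes a: "\<And>i j. i < n \<Longrightarrow> j < n \<Longrightarrow> a i j = a j i"
    and t: "0 < t"
begin

lemma resolvent_left:
  assumes ik: "i < n" "k < n"
  shows "(\<Sum>j<n. of_real (a i j) * resolvent n t a j k) =
    (if i = k then 1 else 0) + \<i> * of_real t * resolvent n t a i k"
proof -
  define l where "l = eigvals n a"
  define u where "u = eigvecs n a"
  have lu: "eigen_decomp n a l u" unfolding l_def u_def by (rule eigen_decomp_eigvals) (rule a)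
  hence u: "orthonormal_basis n u" by (simp add: eigen_decomp_def)
  have au: "(\<Sum>j<n. a i j * u r j) = l r * u r i" if "r < n" for r
  proof -
    have "(\<Sum>j<n. a i j * u r j) = (\<Sum>j<n. \<Sum>s<n. l s * u s i * (u r j * u s j))"
      using lu ik by (simp add: eigen_decomp_def sum_distrib_left sum_distrib_right mult_ac)
    also have "\<dots> = (\<Sum>s<n. l s * u s i * (\<Sum>j<n. u r j * u s j))"
      by (subst sum.swap) (simp add: sum_distrib_left)
    also have "\<dots> = (\<Sum>s<n. if s = r then l s * u s i else 0)"
      using orthonormal_basisD(1)[OF u that] by (intro sum.cong) auto
    finally show ?thesis using that by simp
  qed
  have "(\<Sum>j<n. of_real (a i j) * resolvent n t a j k) =
     (\<Sum>r<n. \<Sum>j<n. of_real (a i j) * (of_real (u r k) * (of_real (u r j) / Complex (l r) (- t))))"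
    unfolding resolvent_def l_def[symmetric] u_def[symmetric]
    by (subst sum.swap) (simp add: sum_distrib_left)
  also have "\<dots> = (\<Sum>r<n. of_real (\<Sum>j<n. a i j * u r j) * (of_real (u r k) / Complex (l r) (- t)))"
    by (intro sum.cong refl) (simp add: sum_distrib_left sum_divide_distrib mult_ac)
  also have "\<dots> = (\<Sum>r<n. of_real (u r i * u r k) + \<i> * of_real t * (of_real (u r k) * (of_real (u r i) / Complex (l r) (- t))))"
  proof (intro sum.cong refl)
    fix r assume "r \<in> {..<n}"
    have nz: "Complex (l r) (- t) \<noteq> 0" using t by (simp add: complex_eq_iff)
    have "of_real (l r) = Complex (l r) (- t) + \<i> * of_real t" by (simp add: complex_eq_iff)
    hence "of_real (\<Sum>j<n. a i j * u r j) = (Complex (l r) (- t) + \<i> * of_real t) * of_real (u r i)"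
      using au \<open>r \<in> {..<n}\<close> by simp
    thus "of_real (\<Sum>j<n. a i j * u r j) * (of_real (u r k) / Complex (l r) (- t)) =
      of_real (u r i * u r k) + \<i> * of_real t * (of_real (u r k) * (of_real (u r i) / Complex (l r) (- t)))"
      using nz by (simp add: field_simps)
  qed
  also have "\<dots> = of_real (\<Sum>r<n. u r i * u r k) + \<i> * of_real t * resolvent n t a i k"
    by (simp add: sum.distrib resolvent_def sum_distrib_left l_def u_def)
  finally show ?thesis using orthonormal_basisD(2)[OF u ik] by simp
qed

lemma resolvent_right:
  assumes ik: "i < n" "k < n"
  shows "(\<Sum>j<n. resolvent n t a i j * of_real (a j k)) =
    (if i = k then 1 else 0) + \<i> * of_real t * resolvent n t a i k"
proof -
  have "(\<Sum>j<n. resolvent n t a i j * of_real (a j k)) = (\<Sum>j<n. of_real (a k j) * resolvent n t a j i)"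
    using a ik by (intro sum.cong) (auto simp: resolvent_sym[of n t a i] mult.commute)
  thus ?thesis using resolvent_left[OF ik(2,1)] by (auto simp: resolvent_sym[of n t a i])
qed

text \<open>The resolvent has operator norm at most \<open>1 / t\<close>, because every \<open>l - it\<close> with real \<open>l\<close> has modulus at
  least \<open>t\<close>.\<close>

lemma resolvent_row_norm:
  assumes i: "i < n"
  shows "(\<Sum>j<n. (cmod (resolvent n t a i j))\<^sup>2) \<le> 1 / t\<^sup>2"
proof -
  define l where "l = eigvals n a"
  define u where "u = eigvecs n a"
  have "eigen_decomp n a l u" unfolding l_def u_def by (rule eigen_decomp_eigvals) (rule a)
  hence u: "orthonormal_basis n u" by (simp add: eigen_decomp_def)
  define z where "z k = of_real (u k i) / Complex (l k) (- t)" for k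
  have G: "resolvent n t a i j = (\<Sum>k<n. of_real (u k j) * z k)" for j
    by (simp add: resolvent_def z_def l_def u_def)
  have "(\<Sum>j<n. (cmod (resolvent n t a i j))\<^sup>2) =
     (\<Sum>j<n. (\<Sum>k<n. u k j * Re (z k))\<^sup>2) + (\<Sum>j<n. (\<Sum>k<n. u k j * Im (z k))\<^sup>2)"
    unfolding cmod_power2 G by (simp add: sum.distrib)
  also have "\<dots> = (\<Sum>k<n. (cmod (z k))\<^sup>2)"
    unfolding parseval[OF orthonormal_basis_transpose[OF u]] cmod_power2 by (simp add: sum.distrib)
  also have "\<dots> \<le> (\<Sum>k<n. u k i * u k i / t\<^sup>2)"
  proof (rule sum_mono)
    fix k
    have "(cmod (z k))\<^sup>2 = u k i * u k i / ((l k)\<^sup>2 + t\<^sup>2)"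
      by (simp add: z_def norm_divide power_divide cmod_power2) (simp add: power2_eq_square)
    also have "\<dots> \<le> u k i * u k i / t\<^sup>2"
      using t by (intro divide_left_mono) (auto intro!: mult_pos_pos add_nonneg_pos)
    finally show "(cmod (z k))\<^sup>2 \<le> u k i * u k i / t\<^sup>2" .
  qed
  also have "\<dots> = 1 / t\<^sup>2"
    using orthonormal_basisD(2)[OF u i i] by (simp flip: sum_divide_distrib)
  finally show ?thesis .
qed

lemma norm_resolvent_le:
  assumes "i < n" "j < n"
  shows "cmod (resolvent n t a i j) \<le> 1 / t"
proof -
  have "(cmod (resolvent n t a i j))\<^sup>2 \<le> (\<Sum>j<n. (cmod (resolvent n t a i j))\<^sup>2)"
    using assms by (intro member_le_sum) auto
  also have "\<dots> \<le> (1 / t)\<^sup>2" using resolvent_row_norm[OF assms(1)] by (simp add: power_divide)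
  finally show ?thesis using t by (auto intro: power2_le_imp_le)
qed

lemma resolvent_trace:
  "(\<Sum>i<n. resolvent n t a i i) = (\<Sum>k<n. 1 / Complex (eigvals n a k) (- t))"
proof -
  have u: "orthonormal_basis n (eigvecs n a)" using eigen_decomp_eigvals[of n a] a by (simp add: eigen_decomp_def)
  have "(\<Sum>i<n. resolvent n t a i i) =
     (\<Sum>k<n. of_real (\<Sum>i<n. eigvecs n a k i * eigvecs n a k i) * (1 / Complex (eigvals n a k) (- t)))"
    unfolding resolvent_def by (subst sum.swap) (simp add: sum_distrib_right sum_divide_distrib)
  also have "\<dots> = (\<Sum>k<n. 1 / Complex (eigvals n a k) (- t))"
    by (intro sum.cong refl) (use orthonormal_basisD(1)[OF u] in simp)
  finally show ?thesis .
qed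

end

text \<open>The resolvent identity \<open>(A - z)\<^sup>-\<^sup>1 - (B - z)\<^sup>-\<^sup>1 = - (B - z)\<^sup>-\<^sup>1 (A - B) (A - z)\<^sup>-\<^sup>1\<close> for a
  perturbation in a single pair of symmetric entries. It comes from evaluating
  \<open>(B - z)\<^sup>-\<^sup>1 A (A - z)\<^sup>-\<^sup>1\<close> and \<open>(B - z)\<^sup>-\<^sup>1 B (A - z)\<^sup>-\<^sup>1\<close> and subtracting.\<close>

lemma resolvent_perturb:
  assumes a: "\<And>i j. i < n \<Longrightarrow> j < n \<Longrightarrow> a i j = a j i"
    and b: "\<And>i j. i < n \<Longrightarrow> j < n \<Longrightarrow> b i j = b j i"
    and t: "0 < t" and xy: "x < n" "y < n" "x \<noteq> y"
    and d: "\<And>i j. i < n \<Longrightarrow> j < n \<Longrightarrow> a i j - b i j = d * sym_unit x y i j"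
    and ik: "i < n" "k < n"
  defines "A \<equiv> resolvent n t a" and "B \<equiv> resolvent n t b"
  shows "A i k - B i k = - of_real d * (B i x * A y k + B i y * A x k)"
proof -
  have delta: "(\<Sum>q<n. B i q * (if q = k then 1 else 0)) = B i k"
    "(\<Sum>q<n. (if i = q then 1 else 0) * A q k) = A i k"
    using ik by (simp_all add: if_distrib if_distribR cong: if_cong)
  have "B i k + \<i> * of_real t * (\<Sum>q<n. B i q * A q k) =
     (\<Sum>q<n. B i q * ((if q = k then 1 else 0) + \<i> * of_real t * A q k))"
    unfolding distrib_left sum.distrib delta by (simp add: sum_distrib_left mult_ac)
  also have "\<dots> = (\<Sum>q<n. B i q * (\<Sum>r<n. of_real (a q r) * A r k))"
    unfolding A_def using ik by (intro sum.cong refl) (simp add: resolvent_left[of n a t, OF a t])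
  also have "\<dots> = (\<Sum>q<n. \<Sum>r<n. B i q * (of_real (a q r) * A r k))"
    by (simp add: sum_distrib_left)
  finally have 1: "B i k + \<i> * of_real t * (\<Sum>q<n. B i q * A q k) = (\<Sum>q<n. \<Sum>r<n. B i q * (of_real (a q r) * A r k))" .
  have "A i k + \<i> * of_real t * (\<Sum>q<n. B i q * A q k) =
     (\<Sum>q<n. ((if i = q then 1 else 0) + \<i> * of_real t * B i q) * A q k)"
    unfolding distrib_right sum.distrib delta by (simp add: sum_distrib_left mult_ac)
  also have "\<dots> = (\<Sum>q<n. (\<Sum>r<n. B i r * of_real (b r q)) * A q k)"
    unfolding B_def using ik by (intro sum.cong refl) (simp add: resolvent_right[of n b t, OF b t])
  also have "\<dots> = (\<Sum>r<n. \<Sum>q<n. B i r * (of_real (b r q) * A q k))"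
    by (subst sum.swap) (simp add: sum_distrib_right mult.assoc)
  finally have 2: "A i k + \<i> * of_real t * (\<Sum>q<n. B i q * A q k) = (\<Sum>q<n. \<Sum>r<n. B i q * (of_real (b q r) * A r k))" .
  have "B i k - A i k = (\<Sum>q<n. \<Sum>r<n. B i q * (of_real (a q r) * A r k)) - (\<Sum>q<n. \<Sum>r<n. B i q * (of_real (b q r) * A r k))"
    unfolding 1[symmetric] 2[symmetric] by simp
  also have "\<dots> = (\<Sum>q<n. \<Sum>r<n. B i q * (of_real (a q r - b q r) * A r k))"
    by (simp add: sum_subtractf algebra_simps)
  also have "\<dots> = (\<Sum>q<n. \<Sum>r<n. sym_unit x y q r *\<^sub>R (of_real d * (B i q * A r k)))"
    by (intro sum.cong refl) (simp add: d scaleR_conv_of_real)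
  also have "\<dots> = of_real d * (B i x * A y k + B i y * A x k)"
    by (subst sum_sym_unit[OF xy]) (simp add: algebra_simps)
  finally show ?thesis by (simp add: algebra_simps)
qed

lemma norm_resolvent_perturb_le:
  assumes a: "\<And>i j. i < n \<Longrightarrow> j < n \<Longrightarrow> a i j = a j i"
    and b: "\<And>i j. i < n \<Longrightarrow> j < n \<Longrightarrow> b i j = b j i"
    and t: "0 < t" and xy: "x < n" "y < n" "x \<noteq> y"
    and d: "\<And>i j. i < n \<Longrightarrow> j < n \<Longrightarrow> a i j - b i j = d * sym_unit x y i j"
    and ik: "i < n" "k < n"
  shows "cmod (resolvent n t a i k - resolvent n t b i k) \<le> 2 * \<bar>d\<bar> / t\<^sup>2"
proof -
  have A: "cmod (resolvent n t a i j) \<le> 1 / t" if "i < n" "j < n" for i j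
    by (rule norm_resolvent_le[OF a t that])
  have B: "cmod (resolvent n t b i j) \<le> 1 / t" if "i < n" "j < n" for i j
    by (rule norm_resolvent_le[OF b t that])
  have "cmod (resolvent n t a i k - resolvent n t b i k) =
    \<bar>d\<bar> * cmod (resolvent n t b i x * resolvent n t a y k + resolvent n t b i y * resolvent n t a x k)"
    by (subst resolvent_perturb[OF a b t xy d ik]) (simp_all add: norm_mult)
  also have "\<dots> \<le> \<bar>d\<bar> * (1 / t * (1 / t) + 1 / t * (1 / t))"
    using t xy ik by (intro mult_left_mono order_trans[OF norm_triangle_ineq] add_mono)
      (auto simp: norm_mult intro!: mult_mono A B simp del: times_divide_eq_left times_divide_eq_right)
  also have "\<dots> = 2 * \<bar>d\<bar> / t\<^sup>2" by (simp add: power2_eq_square)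
  finally show ?thesis .
qed

text \<open>By the Cauchy--Schwarz inequality along rows, the whole trace moves no more than a single entry may.
  This saves a factor \<open>n\<close> and makes the normalised trace concentrate.\<close>

lemma norm_resolvent_trace_perturb_le:
  assumes a: "\<And>i j. i < n \<Longrightarrow> j < n \<Longrightarrow> a i j = a j i"
    and b: "\<And>i j. i < n \<Longrightarrow> j < n \<Longrightarrow> b i j = b j i"
    and t: "0 < t" and xy: "x < n" "y < n" "x \<noteq> y"
    and d: "\<And>i j. i < n \<Longrightarrow> j < n \<Longrightarrow> a i j - b i j = d * sym_unit x y i j"
  shows "cmod ((\<Sum>i<n. resolvent n t a i i) - (\<Sum>i<n. resolvent n t b i i)) \<le> 2 * \<bar>d\<bar> / t\<^sup>2"
proof -
  let ?A = "resolvent n t a" and ?B = "resolvent n t b"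
  have cs: "cmod (\<Sum>i<n. ?B i r * ?A s i) \<le> 1 / t\<^sup>2" if "r < n" "s < n" for r s
  proof -
    have "cmod (\<Sum>i<n. ?B i r * ?A s i) \<le> (\<Sum>i<n. cmod (?B r i) * cmod (?A s i))"
      by (intro order_trans[OF norm_sum]) (simp add: norm_mult resolvent_sym[of n t b r])
    also have "\<dots> \<le> 1 / t\<^sup>2"
    proof (rule power2_le_imp_le)
      have "(\<Sum>i<n. cmod (?B r i) * cmod (?A s i))\<^sup>2 \<le> (\<Sum>i<n. (cmod (?B r i))\<^sup>2) * (\<Sum>i<n. (cmod (?A s i))\<^sup>2)"
        by (rule Cauchy_Schwarz_ineq_sum)
      also have "\<dots> \<le> 1 / t\<^sup>2 * (1 / t\<^sup>2)"
        by (intro mult_mono resolvent_row_norm[OF b t that(1)] resolvent_row_norm[OF a t that(2)]) (auto intro: sum_nonneg)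
      finally show "(\<Sum>i<n. cmod (?B r i) * cmod (?A s i))\<^sup>2 \<le> (1 / t\<^sup>2)\<^sup>2" by (simp add: power2_eq_square)
    qed simp
    finally show ?thesis .
  qed
  have "(\<Sum>i<n. ?A i i) - (\<Sum>i<n. ?B i i) = (\<Sum>i<n. - of_real d * (?B i x * ?A y i + ?B i y * ?A x i))"
    unfolding sum_subtractf[symmetric]
    by (intro sum.cong refl resolvent_perturb[OF a b t xy d]) auto
  also have "\<dots> = - of_real d * ((\<Sum>i<n. ?B i x * ?A y i) + (\<Sum>i<n. ?B i y * ?A x i))"
    by (simp only: sum.distrib sum_distrib_left[symmetric])
  also have "cmod \<dots> \<le> \<bar>d\<bar> * (1 / t\<^sup>2 + 1 / t\<^sup>2)"
    unfolding norm_mult using xy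
    by (intro mult_mono order_trans[OF norm_triangle_ineq] add_mono cs) auto
  finally show ?thesis by (simp add: mult.commute)
qed

section \<open>Random subsets and bounded differences\<close>

text \<open>Expectation over a random subset of \<open>A\<close> that contains each element independently with probability
  \<open>p\<close>. As a finite sum it is linear without integrability conditions, for real and complex values alike;
  \<open>prob_gnp\<close> connects it to the random graph.\<close>

definition expect :: "'a set \<Rightarrow> real \<Rightarrow> ('a set \<Rightarrow> 'b :: real_normed_vector) \<Rightarrow> 'b" where
  "expect A p F = (\<Sum>E\<in>Pow A. (p ^ card E * (1 - p) ^ card (A - E)) *\<^sub>R F E)"

lemma expect_cong:
  "(\<And>E. E \<subseteq> A \<Longrightarrow> F E = G E) \<Longrightarrow> expect A p F = expect A p G"
  unfolding expect_def by (rule sum.cong) auto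

lemma expect_add: "expect A p (\<lambda>E. F E + G E) = expect A p F + expect A p G"
  by (simp add: expect_def scaleR_add_right sum.distrib)

lemma expect_diff: "expect A p (\<lambda>E. F E - G E) = expect A p F - expect A p G"
  by (simp add: expect_def scaleR_diff_right sum_subtractf)

lemma expect_scaleR: "expect A p (\<lambda>E. c *\<^sub>R F E) = c *\<^sub>R expect A p F"
  by (simp add: expect_def scaleR_sum_right mult.commute)

lemma expect_mult_left:
  fixes F :: "_ \<Rightarrow> 'b :: real_normed_algebra"
  shows "expect A p (\<lambda>E. c * F E) = c * expect A p F"
  by (simp add: expect_def sum_distrib_left)

lemma expect_mult_right:
  fixes F :: "_ \<Rightarrow> 'b :: real_normed_algebra"
  shows "expect A p (\<lambda>E. F E * c) = expect A p F * c"
  by (simp add: expect_def sum_distrib_right)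

lemma expect_sum: "expect A p (\<lambda>E. \<Sum>x\<in>X. F x E) = (\<Sum>x\<in>X. expect A p (F x))"
  by (simp add: expect_def scaleR_sum_right sum.swap[of _ X])

lemma expect_insert:
  assumes A: "finite A" "e \<notin> A"
  shows "expect (insert e A) p F =
    expect A p (\<lambda>E. p *\<^sub>R F (insert e E) + (1 - p) *\<^sub>R F E)"
proof -
  let ?w = "\<lambda>E. p ^ card E * (1 - p) ^ card (insert e A - E)"
  have inj: "inj_on (insert e) (Pow A)" using A by (auto simp: inj_on_def)
  have "expect (insert e A) p F = (\<Sum>E\<in>Pow A. ?w E *\<^sub>R F E) + (\<Sum>E\<in>insert e ` Pow A. ?w E *\<^sub>R F E)"
    unfolding expect_def Pow_insert using A by (intro sum.union_disjoint) auto
  also have "(\<Sum>E\<in>insert e ` Pow A. ?w E *\<^sub>R F E) = (\<Sum>E\<in>Pow A. ?w (insert e E) *\<^sub>R F (insert e E))"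
    by (simp add: sum.reindex[OF inj])
  also have "(\<Sum>E\<in>Pow A. ?w (insert e E) *\<^sub>R F (insert e E)) =
      (\<Sum>E\<in>Pow A. (p ^ card E * (1 - p) ^ card (A - E)) *\<^sub>R (p *\<^sub>R F (insert e E)))"
  proof (rule sum.cong)
    fix E assume "E \<in> Pow A"
    hence E: "finite E" "e \<notin> E" "insert e A - insert e E = A - E" using A finite_subset by auto
    have "?w (insert e E) = p ^ card E * (1 - p) ^ card (A - E) * p" unfolding E(3) using E(1,2) by simp
    thus "?w (insert e E) *\<^sub>R F (insert e E) = (p ^ card E * (1 - p) ^ card (A - E)) *\<^sub>R (p *\<^sub>R F (insert e E))"
      by simp
  qed simp
  also have "(\<Sum>E\<in>Pow A. ?w E *\<^sub>R F E) =
      (\<Sum>E\<in>Pow A. (p ^ card E * (1 - p) ^ card (A - E)) *\<^sub>R ((1 - p) *\<^sub>R F E))"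
  proof (rule sum.cong)
    fix E assume "E \<in> Pow A"
    hence E: "finite (A - E)" "e \<notin> A - E" "insert e A - E = insert e (A - E)" using A by auto
    have "?w E = p ^ card E * (1 - p) ^ card (A - E) * (1 - p)" unfolding E(3) using E(1,2) by simp
    thus "?w E *\<^sub>R F E = (p ^ card E * (1 - p) ^ card (A - E)) *\<^sub>R ((1 - p) *\<^sub>R F E)" by simp
  qed simp
  finally show ?thesis by (simp only: expect_add add.commute) (simp only: expect_def)
qed

lemma expect_const: "finite A \<Longrightarrow> expect A p (\<lambda>_. c) = c"
proof (induction A rule: finite_induct)
  case empty
  show ?case by (simp add: expect_def)
next
  case (insert e A)
  thus ?case by (simp add: expect_insert flip: scaleR_add_left)
qed

lemma expect_mono:
  fixes F G :: "_ \<Rightarrow> real"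
  assumes "0 \<le> p" "p \<le> 1" "\<And>E. E \<subseteq> A \<Longrightarrow> F E \<le> G E"
  shows "expect A p F \<le> expect A p G"
  unfolding expect_def using assms by (intro sum_mono) (auto intro!: mult_left_mono)

lemma norm_expect_le:
  assumes "0 \<le> p" "p \<le> 1"
  shows "norm (expect A p F) \<le> expect A p (\<lambda>E. norm (F E))"
  unfolding expect_def using assms by (intro order_trans[OF norm_sum]) simp

lemma norm_expect_le_const:
  assumes "finite A" "0 \<le> p" "p \<le> 1" "\<And>E. E \<subseteq> A \<Longrightarrow> norm (F E) \<le> c"
  shows "norm (expect A p F) \<le> c"
proof -
  have "norm (expect A p F) \<le> expect A p (\<lambda>E. norm (F E))" using assms by (intro norm_expect_le)
  also have "\<dots> \<le> expect A p (\<lambda>_. c)" using assms by (intro expect_mono)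
  finally show ?thesis using assms by (simp add: expect_const)
qed

lemma expect_resample:
  assumes "finite A" "e \<in> A"
  shows "expect A p F = expect A p (\<lambda>E. p *\<^sub>R F (insert e E) + (1 - p) *\<^sub>R F (E - {e}))"
proof -
  define B where "B = A - {e}"
  have B: "finite B" "e \<notin> B" and A: "A = insert e B" using assms by (auto simp: B_def)
  have "expect A p (\<lambda>E. p *\<^sub>R F (insert e E) + (1 - p) *\<^sub>R F (E - {e})) =
     expect B p (\<lambda>E. p *\<^sub>R F (insert e E) + (1 - p) *\<^sub>R F E)"
    unfolding A expect_insert[OF B]
  proof (rule expect_cong)
    fix E assume "E \<subseteq> B"
    hence "E - {e} = E" using B by auto
    thus "p *\<^sub>R (p *\<^sub>R F (insert e (insert e E)) + (1 - p) *\<^sub>R F (insert e E - {e})) +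
         (1 - p) *\<^sub>R (p *\<^sub>R F (insert e E) + (1 - p) *\<^sub>R F (E - {e})) =
         p *\<^sub>R F (insert e E) + (1 - p) *\<^sub>R F E"
      by (simp add: algebra_simps)
  qed
  thus ?thesis by (simp add: A expect_insert[OF B])
qed

text \<open>An exact integration by parts for Bernoulli variables: the centered indicator of \<open>e\<close> turns into the
  discrete derivative in the direction of \<open>e\<close>.\<close>

lemma expect_centered:
  assumes "finite A" "e \<in> A"
  shows "expect A p (\<lambda>E. (of_bool (e \<in> E) - p) *\<^sub>R F E) =
    (p * (1 - p)) *\<^sub>R expect A p (\<lambda>E. F (insert e E) - F (E - {e}))"
  by (subst expect_resample[OF assms]) (simp add: algebra_simps flip: expect_scaleR)

text \<open>Hoeffding's lemma for a centered Bernoulli variable scaled by \<open>h\<close>. The case of negative \<open>h\<close> is the one of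
  positive \<open>h\<close> with \<open>p\<close> and \<open>1 - p\<close> exchanged.\<close>

lemma two_point_mgf_le:
  fixes p h :: real
  assumes "0 \<le> p" "p \<le> 1"
  shows "p * exp ((1 - p) * h) + (1 - p) * exp (- (p * h)) \<le> exp (h\<^sup>2 / 8)"
proof -
  have nonneg: "p * exp ((1 - p) * h) + (1 - p) * exp (- (p * h)) \<le> exp (h\<^sup>2 / 8)"
    if p: "0 \<le> p" "p \<le> 1" and h: "0 \<le> h" for p h :: real
  proof -
    have pos: "1 + p * (exp h - 1) > 0" using p h by (simp add: add_pos_nonneg)
    have "p * exp ((1 - p) * h) + (1 - p) * exp (- (p * h)) = exp (- h * p) * (1 + p * (exp h - 1))"
      by (simp add: algebra_simps flip: exp_add)
    also have "\<dots> = exp (- h * p + ln (1 + p * (exp h - 1)))" by (simp only: exp_add exp_ln[OF pos])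
    also have "\<dots> \<le> exp (h\<^sup>2 / 8)" using Hoeffdings_lemma_aux[OF h p(1)] by simp
    finally show ?thesis .
  qed
  show ?thesis
  proof (cases "0 \<le> h")
    case True
    thus ?thesis using nonneg assms by blast
  next
    case False
    thus ?thesis using nonneg[of "1 - p" "- h"] assms by (simp add: algebra_simps)
  qed
qed

text \<open>McDiarmid's inequality in exponential form. Averaging out one element \<open>e\<close> replaces \<open>F\<close> by a function \<open>g\<close>
  on subsets of the remaining elements that has the same bounded differences, and the fluctuation of
  \<open>F\<close> around \<open>g\<close> is a two-point variable of range at most \<open>c e\<close>.\<close>

theorem bounded_differences_mgf:
  fixes F :: "'a set \<Rightarrow> real"
  assumes "finite A" "0 \<le> p" "p \<le> 1"
    and "\<And>E e. E \<subseteq> A \<Longrightarrow> e \<in> A \<Longrightarrow> \<bar>F (insert e E) - F (E - {e})\<bar> \<le> c e"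
  shows "expect A p (\<lambda>E. exp (s * (F E - expect A p F))) \<le> exp (s\<^sup>2 * (\<Sum>e\<in>A. (c e)\<^sup>2) / 8)"
  using assms(1,4)
proof (induction A arbitrary: F rule: finite_induct)
  case empty
  show ?case by (simp add: expect_def)
next
  case (insert e A)
  define g where "g E = p * F (insert e E) + (1 - p) * F E" for E
  define D where "D E = F (insert e E) - F E" for E
  have mean: "expect (insert e A) p F = expect A p g"
    using insert.hyps by (simp add: expect_insert g_def[abs_def])
  have D: "\<bar>D E\<bar> \<le> c e" if "E \<subseteq> A" for E
  proof -
    have "E - {e} = E" using that insert.hyps by auto
    thus ?thesis using insert.prems[of E e] that by (auto simp: D_def)
  qed
  have g: "\<bar>g (insert x E) - g (E - {x})\<bar> \<le> c x" if "E \<subseteq> A" "x \<in> A" for E x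
  proof -
    have "insert e (E - {x}) = insert e E - {x}" "insert x (insert e E) = insert e (insert x E)"
      using that insert.hyps by auto
    hence "g (insert x E) - g (E - {x}) =
      p * (F (insert x (insert e E)) - F (insert e E - {x})) + (1 - p) * (F (insert x E) - F (E - {x}))"
      by (simp add: g_def algebra_simps)
    also have "\<bar>\<dots>\<bar> \<le> p * c x + (1 - p) * c x"
      using that assms(2,3) insert.prems[of "insert e E" x] insert.prems[of E x]
      by (intro order_trans[OF abs_triangle_ineq] add_mono) (auto simp: abs_mult intro!: mult_left_mono)
    finally show ?thesis by (simp add: algebra_simps)
  qed
  let ?m = "expect A p g"
  have "expect (insert e A) p (\<lambda>E. exp (s * (F E - ?m))) =
     expect A p (\<lambda>E. p * exp (s * (F (insert e E) - ?m)) + (1 - p) * exp (s * (F E - ?m)))"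
    using insert.hyps by (simp add: expect_insert)
  also have "\<dots> = expect A p (\<lambda>E. exp (s * (g E - ?m)) *
      (p * exp ((1 - p) * (s * D E)) + (1 - p) * exp (- (p * (s * D E)))))"
  proof (rule expect_cong)
    fix E
    have "s * (F (insert e E) - ?m) = s * (g E - ?m) + (1 - p) * (s * D E)"
      "s * (F E - ?m) = s * (g E - ?m) + - (p * (s * D E))"
      by (simp_all add: g_def D_def algebra_simps)
    thus "p * exp (s * (F (insert e E) - ?m)) + (1 - p) * exp (s * (F E - ?m)) = exp (s * (g E - ?m)) *
      (p * exp ((1 - p) * (s * D E)) + (1 - p) * exp (- (p * (s * D E))))"
      by (simp only: exp_add distrib_left mult.left_commute)
  qed
  also have "\<dots> \<le> expect A p (\<lambda>E. exp (s * (g E - ?m)) * exp (s\<^sup>2 * (c e)\<^sup>2 / 8))"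
  proof (rule expect_mono[OF assms(2,3)])
    fix E assume "E \<subseteq> A"
    hence "\<bar>D E\<bar>\<^sup>2 \<le> (c e)\<^sup>2" using D by (intro power_mono) auto
    hence "(D E)\<^sup>2 \<le> (c e)\<^sup>2" by simp
    hence "(s * D E)\<^sup>2 / 8 \<le> s\<^sup>2 * (c e)\<^sup>2 / 8" by (simp add: power_mult_distrib mult_left_mono)
    hence "p * exp ((1 - p) * (s * D E)) + (1 - p) * exp (- (p * (s * D E))) \<le> exp (s\<^sup>2 * (c e)\<^sup>2 / 8)"
      using two_point_mgf_le[OF assms(2,3), of "s * D E"] by (meson exp_le_cancel_iff order_trans)
    thus "exp (s * (g E - ?m)) * (p * exp ((1 - p) * (s * D E)) + (1 - p) * exp (- (p * (s * D E))))
       \<le> exp (s * (g E - ?m)) * exp (s\<^sup>2 * (c e)\<^sup>2 / 8)" by simp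
  qed
  also have "\<dots> = expect A p (\<lambda>E. exp (s * (g E - ?m))) * exp (s\<^sup>2 * (c e)\<^sup>2 / 8)"
    by (rule expect_mult_right)
  also have "\<dots> \<le> exp (s\<^sup>2 * (\<Sum>e\<in>A. (c e)\<^sup>2) / 8) * exp (s\<^sup>2 * (c e)\<^sup>2 / 8)"
    by (intro mult_right_mono insert.IH g) auto
  also have "\<dots> = exp (s\<^sup>2 * (\<Sum>e\<in>insert e A. (c e)\<^sup>2) / 8)"
    using insert.hyps by (simp add: algebra_simps add_divide_distrib flip: exp_add)
  finally show ?case unfolding mean .
qed

theorem bounded_differences_tail:
  fixes F :: "'a set \<Rightarrow> real"
  assumes A: "finite A" "0 \<le> p" "p \<le> 1"
    and c: "\<And>E e. E \<subseteq> A \<Longrightarrow> e \<in> A \<Longrightarrow> \<bar>F (insert e E) - F (E - {e})\<bar> \<le> c e"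
    and K: "(\<Sum>e\<in>A. (c e)\<^sup>2) \<le> K" "0 < K" and r: "0 < r"
  shows "expect A p (\<lambda>E. of_bool (r \<le> \<bar>F E - expect A p F\<bar>)) \<le> 2 * exp (- 2 * r\<^sup>2 / K)"
proof -
  \<comment> \<open>This value minimises the exponent \<open>s\<^sup>2 * K / 8 - s * r\<close>.\<close>
  define s where "s = 4 * r / K"
  let ?m = "expect A p F"
  have s: "s > 0" using K r by (simp add: s_def)
  have mgf: "expect A p (\<lambda>E. exp (t * (F E - ?m))) \<le> exp (s\<^sup>2 * K / 8)" if "t\<^sup>2 = s\<^sup>2" for t
  proof -
    have "expect A p (\<lambda>E. exp (t * (F E - ?m))) \<le> exp (t\<^sup>2 * (\<Sum>e\<in>A. (c e)\<^sup>2) / 8)"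
      by (rule bounded_differences_mgf[OF A c])
    also have "\<dots> \<le> exp (s\<^sup>2 * K / 8)" using K that by (simp add: mult_left_mono)
    finally show ?thesis .
  qed
  have "expect A p (\<lambda>E. of_bool (r \<le> \<bar>F E - ?m\<bar>)) \<le>
     expect A p (\<lambda>E. exp (- s * r) * (exp (s * (F E - ?m)) + exp (- s * (F E - ?m))))"
  proof (rule expect_mono[OF A(2,3)])
    fix E
    let ?x = "F E - ?m"
    have "of_bool (r \<le> \<bar>?x\<bar>) \<le> exp (- s * r) * exp (s * \<bar>?x\<bar>)"
      using s by (simp add: mult_left_mono flip: exp_add)
    also have "exp (s * \<bar>?x\<bar>) \<le> exp (s * ?x) + exp (- s * ?x)"
    proof -
      have "s * \<bar>?x\<bar> = s * ?x \<or> s * \<bar>?x\<bar> = - s * ?x" by (auto simp: abs_if algebra_simps)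
      thus ?thesis by (elim disjE) (simp_all only: le_add_same_cancel1 le_add_same_cancel2 exp_ge_zero)
    qed
    finally show "of_bool (r \<le> \<bar>?x\<bar>) \<le> exp (- s * r) * (exp (s * ?x) + exp (- s * ?x))" by simp
  qed
  also have "\<dots> = exp (- s * r) * (expect A p (\<lambda>E. exp (s * (F E - ?m))) + expect A p (\<lambda>E. exp (- s * (F E - ?m))))"
    by (simp only: expect_mult_left expect_add)
  also have "\<dots> \<le> exp (- s * r) * (exp (s\<^sup>2 * K / 8) + exp (s\<^sup>2 * K / 8))"
    by (intro mult_left_mono add_mono mgf) auto
  also have "\<dots> = 2 * exp (- s * r + s\<^sup>2 * K / 8)" by (simp only: exp_add distrib_left mult_2)
  also have "- s * r + s\<^sup>2 * K / 8 = - 2 * r\<^sup>2 / K"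
    using K by (simp add: s_def field_simps power2_eq_square)
  finally show ?thesis .
qed

text \<open>The exponential moment at the scale \<open>1 / sqrt K\<close> already controls the second moment, because
  \<open>x\<^sup>2 / 2 \<le> exp x + exp (- x)\<close>.\<close>

theorem bounded_differences_variance:
  fixes F :: "'a set \<Rightarrow> real"
  assumes A: "finite A" "0 \<le> p" "p \<le> 1"
    and c: "\<And>E e. E \<subseteq> A \<Longrightarrow> e \<in> A \<Longrightarrow> \<bar>F (insert e E) - F (E - {e})\<bar> \<le> c e"
    and K: "(\<Sum>e\<in>A. (c e)\<^sup>2) \<le> K" "0 < K"
  shows "expect A p (\<lambda>E. (F E - expect A p F)\<^sup>2) \<le> 2 * K"
proof -
  \<comment> \<open>This value makes the exponent \<open>s\<^sup>2 * K / 8\<close> equal to 1.\<close>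
  define s where "s = sqrt (8 / K)"
  let ?m = "expect A p F"
  have s: "s\<^sup>2 = 8 / K" using K by (simp add: s_def)
  have mgf: "expect A p (\<lambda>E. exp (t * (F E - ?m))) \<le> 3" if "t\<^sup>2 = s\<^sup>2" for t
  proof -
    have "expect A p (\<lambda>E. exp (t * (F E - ?m))) \<le> exp (t\<^sup>2 * (\<Sum>e\<in>A. (c e)\<^sup>2) / 8)"
      by (rule bounded_differences_mgf[OF A c])
    also have "t\<^sup>2 * (\<Sum>e\<in>A. (c e)\<^sup>2) \<le> t\<^sup>2 * K" using K by (intro mult_left_mono) auto
    hence "exp (t\<^sup>2 * (\<Sum>e\<in>A. (c e)\<^sup>2) / 8) \<le> exp 1" using K by (simp add: that s)
    finally show ?thesis using exp_le by simp
  qed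
  have "expect A p (\<lambda>E. s\<^sup>2 / 2 * (F E - ?m)\<^sup>2) \<le>
     expect A p (\<lambda>E. exp (s * (F E - ?m)) + exp (- s * (F E - ?m)))"
  proof (rule expect_mono[OF A(2,3)])
    fix E
    let ?x = "s * (F E - ?m)"
    have "?x\<^sup>2 / 2 \<le> exp \<bar>?x\<bar>" using exp_lower_Taylor_quadratic[of "\<bar>?x\<bar>"] by simp
    also have "\<dots> \<le> exp ?x + exp (- ?x)" by (cases "?x \<ge> 0") (auto simp: abs_if)
    finally show "s\<^sup>2 / 2 * (F E - ?m)\<^sup>2 \<le> exp (s * (F E - ?m)) + exp (- s * (F E - ?m))"
      by (simp add: power_mult_distrib)
  qed
  also have "\<dots> \<le> 3 + 3" unfolding expect_add by (intro add_mono mgf) auto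
  finally have "4 / K * expect A p (\<lambda>E. (F E - ?m)\<^sup>2) \<le> 6" by (simp only: expect_mult_left s) simp
  thus ?thesis using K by (simp add: field_simps)
qed

lemma finite_all_edges: "finite (all_edges n)"
  by (rule finite_subset[of _ "Pow {1..n}"]) (auto simp: all_edges_def)

lemma pmf_gnp:
  assumes "0 \<le> p" "p \<le> 1"
  shows "pmf (gnp n p) E = (if E \<subseteq> all_edges n then p ^ card E * (1 - p) ^ card (all_edges n - E) else 0)"
proof -
  let ?A = "all_edges n" 
  have inj: "inj (Collect :: (nat set \<Rightarrow> bool) \<Rightarrow> _)" by (auto simp: inj_def)
  have "pmf (gnp n p) (Collect (\<lambda>e. e \<in> E)) = pmf (Pi_pmf ?A False (\<lambda>_. bernoulli_pmf p)) (\<lambda>e. e \<in> E)"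
    unfolding gnp_def by (rule pmf_map_inj'[OF inj])
  also have "\<dots> = (if E \<subseteq> ?A then \<Prod>e\<in>?A. pmf (bernoulli_pmf p) (e \<in> E) else 0)"
    unfolding pmf_Pi[OF finite_all_edges] by (auto simp: subset_iff)
  also have "(\<Prod>e\<in>?A. pmf (bernoulli_pmf p) (e \<in> E)) = p ^ card E * (1 - p) ^ card (?A - E)" if "E \<subseteq> ?A"
  proof -
    have "(\<Prod>e\<in>?A. pmf (bernoulli_pmf p) (e \<in> E)) =
       (\<Prod>e\<in>E. pmf (bernoulli_pmf p) (e \<in> E)) * (\<Prod>e\<in>?A - E. pmf (bernoulli_pmf p) (e \<in> E))"
      using that finite_all_edges by (metis prod.subset_diff mult.commute)
    thus ?thesis using assms by simp
  qed
  hence "(if E \<subseteq> ?A then \<Prod>e\<in>?A. pmf (bernoulli_pmf p) (e \<in> E) else 0) =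
    (if E \<subseteq> all_edges n then p ^ card E * (1 - p) ^ card (all_edges n - E) else 0)" by simp
  finally show ?thesis by simp
qed

lemma prob_gnp:
  assumes "0 \<le> p" "p \<le> 1"
  shows "measure_pmf.prob (gnp n p) S = expect (all_edges n) p (\<lambda>E. of_bool (E \<in> S))"
proof -
  have "set_pmf (gnp n p) \<subseteq> Pow (all_edges n)"
    by (auto simp: set_pmf_eq pmf_gnp[OF assms] split: if_splits)
  hence "measure_pmf.prob (gnp n p) S = measure_pmf.prob (gnp n p) (S \<inter> Pow (all_edges n))"
    by (intro measure_prob_cong_0) (auto simp: set_pmf_eq)
  also have "\<dots> = (\<Sum>E\<in>S \<inter> Pow (all_edges n). pmf (gnp n p) E)"
    by (rule measure_measure_pmf_finite) (simp add: finite_all_edges)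
  also have "\<dots> = expect (all_edges n) p (\<lambda>E. of_bool (E \<in> S))"
    unfolding expect_def
    by (rule sum.mono_neutral_cong_left) (auto simp: finite_all_edges pmf_gnp[OF assms])
  finally show ?thesis .
qed

section \<open>The loop equation of the centered adjacency matrix\<close>

text \<open>Row and column \<open>i\<close> belong to vertex \<open>Suc i\<close>. Dividing by \<open>sqrt n\<close> keeps the bulk of the spectrum bounded.\<close>

definition centered_adj :: "real \<Rightarrow> nat \<Rightarrow> nat set set \<Rightarrow> nat \<Rightarrow> nat \<Rightarrow> real" where
  "centered_adj p n E i j = (if i = j then 0 else (of_bool ({Suc i, Suc j} \<in> E) - p) / sqrt (real n))"

lemma centered_adj_sym: "centered_adj p n E i j = centered_adj p n E j i"
  by (simp add: centered_adj_def insert_commute)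

lemma edge_in_all_edges: "i < n \<Longrightarrow> j < n \<Longrightarrow> i \<noteq> j \<Longrightarrow> {Suc i, Suc j} \<in> all_edges n"
  by (auto simp: all_edges_def)

lemma all_edgesE:
  assumes "e \<in> all_edges n"
  obtains x y where "x < n" "y < n" "x \<noteq> y" "e = {Suc x, Suc y}"
proof -
  obtain v w where vw: "e = {v, w}" "v \<noteq> w" using assms by (auto simp: all_edges_def card_2_iff)
  hence "v \<in> {1..n}" "w \<in> {1..n}" using assms by (auto simp: all_edges_def)
  thus ?thesis using that[of "v - 1" "w - 1"] vw by auto
qed

lemma card_all_edges_le: "real (card (all_edges n)) \<le> (real n)\<^sup>2"
proof -
  have "card (all_edges n) = n choose 2"
    unfolding all_edges_def using n_subsets[of "{1..n}" 2] by simp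
  also have "\<dots> \<le> n ^ 2" using binomial_fact_pow[of n 2] by (simp add: fact_2)
  finally show ?thesis by (metis of_nat_le_iff of_nat_power)
qed

lemma centered_adj_diff:
  assumes "x \<noteq> y" "E - {{Suc x, Suc y}} = E' - {{Suc x, Suc y}}"
  shows "centered_adj p n E i j - centered_adj p n E' i j =
    (of_bool ({Suc x, Suc y} \<in> E) - of_bool ({Suc x, Suc y} \<in> E')) / sqrt (real n) * sym_unit x y i j"
proof (cases "{Suc i, Suc j} = {Suc x, Suc y}")
  case True
  hence "i = x \<and> j = y \<or> i = y \<and> j = x" by (auto simp: doubleton_eq_iff)
  thus ?thesis using assms(1)
    by (elim disjE conjE) (simp_all add: centered_adj_def sym_unit_def insert_commute[of "Suc y" "Suc x"] flip: diff_divide_distrib)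
next
  case False
  hence "{Suc i, Suc j} \<in> E \<longleftrightarrow> {Suc i, Suc j} \<in> E'"
    using arg_cong[OF assms(2), of "\<lambda>S. {Suc i, Suc j} \<in> S"] by simp
  moreover have "sym_unit x y i j = 0" using False by (auto simp: sym_unit_def)
  ultimately show ?thesis by (simp add: centered_adj_def)
qed

text \<open>The Stieltjes transform of the empirical spectral distribution, at the point \<open>it\<close>.\<close>

definition stieltjes :: "nat \<Rightarrow> real \<Rightarrow> (nat \<Rightarrow> nat \<Rightarrow> real) \<Rightarrow> complex" where
  "stieltjes n t a = (\<Sum>i<n. resolvent n t a i i) / of_nat n"

lemma norm_resolvent_centered_adj_diff_le:
  assumes "0 < t" "x < n" "y < n" "x \<noteq> y" "i < n" "k < n"
    and "E - {{Suc x, Suc y}} = E' - {{Suc x, Suc y}}"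
  shows "cmod (resolvent n t (centered_adj p n E) i k - resolvent n t (centered_adj p n E') i k) \<le> 2 / (sqrt (real n) * t\<^sup>2)"
proof -
  let ?d = "(of_bool ({Suc x, Suc y} \<in> E) - of_bool ({Suc x, Suc y} \<in> E')) / sqrt (real n)"
  have "cmod (resolvent n t (centered_adj p n E) i k - resolvent n t (centered_adj p n E') i k) \<le> 2 * \<bar>?d\<bar> / t\<^sup>2"
    by (rule norm_resolvent_perturb_le[OF centered_adj_sym centered_adj_sym assms(1-4) centered_adj_diff[OF assms(4,7)] assms(5,6)])
  also have "\<dots> \<le> 2 / (sqrt (real n) * t\<^sup>2)"
    using assms by (auto simp: of_bool_def field_simps)
  finally show ?thesis .
qed

lemma norm_stieltjes_centered_adj_diff_le:
  assumes "0 < t" "x < n" "y < n" "x \<noteq> y"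
    and "E - {{Suc x, Suc y}} = E' - {{Suc x, Suc y}}"
  shows "cmod (stieltjes n t (centered_adj p n E) - stieltjes n t (centered_adj p n E')) \<le> 2 / (n * sqrt (real n) * t\<^sup>2)"
proof -
  let ?d = "(of_bool ({Suc x, Suc y} \<in> E) - of_bool ({Suc x, Suc y} \<in> E')) / sqrt (real n)"
  have "cmod ((\<Sum>i<n. resolvent n t (centered_adj p n E) i i) - (\<Sum>i<n. resolvent n t (centered_adj p n E') i i)) \<le> 2 * \<bar>?d\<bar> / t\<^sup>2"
    by (rule norm_resolvent_trace_perturb_le[OF centered_adj_sym centered_adj_sym assms(1-4) centered_adj_diff[OF assms(4,5)]])
  also have "\<dots> \<le> 2 / (sqrt (real n) * t\<^sup>2)"
    using assms by (auto simp: of_bool_def field_simps)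
  finally have "cmod ((\<Sum>i<n. resolvent n t (centered_adj p n E) i i) - (\<Sum>i<n. resolvent n t (centered_adj p n E') i i)) / n
     \<le> 2 / (sqrt (real n) * t\<^sup>2) / n" by (rule divide_right_mono) simp
  thus ?thesis unfolding stieltjes_def diff_divide_distrib[symmetric] norm_divide by (simp add: mult_ac)
qed

text \<open>One edge moves the transform by at most \<open>2 / (n * sqrt n * t\<^sup>2)\<close>, and there are at most \<open>n\<^sup>2\<close>
  edges; the bounded-differences variance bound applies to the real and to the imaginary part.\<close>

lemma stieltjes_variance:
  assumes t: "0 < t" and n: "0 < n" and p: "0 \<le> p" "p \<le> 1"
  defines "m \<equiv> expect (all_edges n) p (\<lambda>E. stieltjes n t (centered_adj p n E))"
  shows "cmod (expect (all_edges n) p (\<lambda>E. (stieltjes n t (centered_adj p n E))\<^sup>2) - m\<^sup>2) \<le> 16 / (n * t ^ 4)"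
proof -
  define A where "A = all_edges n"
  have A: "finite A" by (simp add: A_def finite_all_edges)
  define s where "s E = stieltjes n t (centered_adj p n E)" for E
  define c where "c = 2 / (n * sqrt (real n) * t\<^sup>2)"
  have sd: "cmod (s (insert e E) - s (E - {e})) \<le> c" if e: "e \<in> A" for E e
  proof -
    obtain x y where xy: "x < n" "y < n" "x \<noteq> y" "e = {Suc x, Suc y}"
      using e all_edgesE unfolding A_def by metis
    show ?thesis unfolding s_def c_def xy(4)
      by (rule norm_stieltjes_centered_adj_diff_le[OF t xy(1-3)]) auto
  qed
  have "(\<Sum>e\<in>A. c\<^sup>2) = card A * c\<^sup>2" by simp
  also have "\<dots> \<le> (real n)\<^sup>2 * c\<^sup>2" unfolding A_def by (intro mult_right_mono card_all_edges_le) auto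
  also have "\<dots> = 4 / (n * t ^ 4)"
    using n t by (simp add: c_def power_divide power_mult_distrib power2_eq_square power4_eq_xxxx)
  finally have K: "(\<Sum>e\<in>A. c\<^sup>2) \<le> 4 / (n * t ^ 4)" .
  have K0: "0 < 4 / (n * t ^ 4)" using n t by simp
  have ReIm: "Re m = expect A p (\<lambda>E. Re (s E))" "Im m = expect A p (\<lambda>E. Im (s E))"
    by (simp_all add: m_def A_def s_def expect_def)
  have "expect A p (\<lambda>E. (s E - m)\<^sup>2) = expect A p (\<lambda>E. (s E)\<^sup>2 - (2 * m * s E - m\<^sup>2))"
    by (rule expect_cong) (simp add: power2_diff algebra_simps)
  also have "\<dots> = expect A p (\<lambda>E. (s E)\<^sup>2) - (2 * m * m - m\<^sup>2)"
    unfolding expect_diff expect_mult_left expect_const[OF A] by (simp add: m_def A_def s_def)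
  finally have eq: "expect A p (\<lambda>E. (s E)\<^sup>2) - m\<^sup>2 = expect A p (\<lambda>E. (s E - m)\<^sup>2)"
    by (simp add: power2_eq_square)
  have "cmod (expect A p (\<lambda>E. (s E - m)\<^sup>2)) \<le> expect A p (\<lambda>E. cmod ((s E - m)\<^sup>2))"
    by (rule norm_expect_le[OF p])
  also have "\<dots> = expect A p (\<lambda>E. (Re (s E) - Re m)\<^sup>2) + expect A p (\<lambda>E. (Im (s E) - Im m)\<^sup>2)"
    unfolding expect_add[symmetric] by (rule expect_cong) (simp add: norm_power cmod_power2)
  also have "\<dots> \<le> 2 * (4 / (n * t ^ 4)) + 2 * (4 / (n * t ^ 4))"
    unfolding ReIm
  proof (intro add_mono bounded_differences_variance[OF A p _ K K0])
    fix E e assume e: "e \<in> A"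
    show "\<bar>Re (s (insert e E)) - Re (s (E - {e}))\<bar> \<le> c"
      using sd[OF e, of E] abs_Re_le_cmod[of "s (insert e E) - s (E - {e})"] by simp
    show "\<bar>Im (s (insert e E)) - Im (s (E - {e}))\<bar> \<le> c"
      using sd[OF e, of E] abs_Im_le_cmod[of "s (insert e E) - s (E - {e})"] by simp
  qed
  finally show ?thesis unfolding eq[symmetric] by (simp add: A_def s_def)
qed

lemma norm_mult_diff_le:
  fixes a b c d :: complex
  assumes "cmod (a - c) \<le> \<delta>" "cmod (b - d) \<le> \<delta>" "cmod b \<le> M" "cmod c \<le> M"
  shows "cmod (a * b - c * d) \<le> 2 * M * \<delta>"
proof -
  have nonneg: "0 \<le> \<delta>" "0 \<le> M" using assms norm_ge_zero order_trans by blast+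
  have "a * b - c * d = (a - c) * b + c * (b - d)" by (simp add: algebra_simps)
  also have "cmod \<dots> \<le> \<delta> * M + M * \<delta>"
    using assms nonneg
    by (intro order_trans[OF norm_triangle_ineq] add_mono) (auto simp: norm_mult intro!: mult_mono)
  finally show ?thesis by simp
qed

text \<open>Integration by parts in the entry at \<open>(i, j)\<close>. The discrete derivative of the resolvent is a
  product of resolvents of the two graphs with and without the edge, and both differ from the
  resolvent of the random graph itself by a term of order \<open>1 / sqrt n\<close> only.\<close>

lemma expect_entry_times_resolvent:
  assumes t: "0 < t" and n: "0 < n" and p: "0 \<le> p" "p \<le> 1" and ij: "i < n" "j < n" "i \<noteq> j"
  defines "G \<equiv> \<lambda>E. resolvent n t (centered_adj p n E)"
  shows "cmod (expect (all_edges n) p (\<lambda>E. of_real (centered_adj p n E i j) * G E j i) +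
      of_real (p * (1 - p) / n) * expect (all_edges n) p (\<lambda>E. (G E j i)\<^sup>2 + G E j j * G E i i))
    \<le> p * (1 - p) / n * (8 / (sqrt (real n) * t ^ 3))"
proof -
  define A where "A = all_edges n"
  have A: "finite A" by (simp add: A_def finite_all_edges)
  define e where "e = {Suc i, Suc j}"
  have e: "e \<in> A" using ij by (simp add: e_def A_def edge_in_all_edges)
  define c where "c = p * (1 - p) / n"
  have c: "0 \<le> c" using p by (simp add: c_def)
  define r where "r = sqrt (real n)"
  have r: "r > 0" "r * r = n" using n by (auto simp: r_def)
  have G: "cmod (G E x y) \<le> 1 / t" if "x < n" "y < n" for E x y
    unfolding G_def using centered_adj_sym t that by (intro norm_resolvent_le)
  have Gd: "cmod (G E x y - G E' x y) \<le> 2 / (r * t\<^sup>2)" if "x < n" "y < n" "E - {e} = E' - {e}" for E E' x y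
    unfolding G_def r_def using t ij that unfolding e_def by (intro norm_resolvent_centered_adj_diff_le) auto
  \<comment> \<open>Both factors in the resolvent identity may be replaced by the resolvent at the random graph itself.\<close>
  define R where "R E = (G E j i)\<^sup>2 + G E j j * G E i i" for E
  define S where "S E = G (E - {e}) j i * G (insert e E) j i + G (E - {e}) j j * G (insert e E) i i" for E
  have "expect A p (\<lambda>E. of_real (centered_adj p n E i j) * G E j i) =
     expect A p (\<lambda>E. (1 / r) *\<^sub>R ((of_bool (e \<in> E) - p) *\<^sub>R G E j i))"
    using ij by (intro expect_cong) (simp add: centered_adj_def e_def r_def scaleR_conv_of_real)
  also have "\<dots> = (1 / r) *\<^sub>R ((p * (1 - p)) *\<^sub>R expect A p (\<lambda>E. G (insert e E) j i - G (E - {e}) j i))"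
    by (simp only: expect_scaleR expect_centered[OF A e])
  also have "expect A p (\<lambda>E. G (insert e E) j i - G (E - {e}) j i) = expect A p (\<lambda>E. (- 1 / r) *\<^sub>R S E)"
  proof (rule expect_cong)
    fix E
    have eq: "insert e E - {{Suc i, Suc j}} = E - {e} - {{Suc i, Suc j}}" by (auto simp: e_def)
    show "G (insert e E) j i - G (E - {e}) j i = (- 1 / r) *\<^sub>R S E"
      unfolding G_def S_def
      by (subst resolvent_perturb[OF centered_adj_sym centered_adj_sym t ij centered_adj_diff[OF ij(3) eq] ij(2,1)])
        (simp_all add: e_def r_def scaleR_conv_of_real)
  qed
  finally have "expect A p (\<lambda>E. of_real (centered_adj p n E i j) * G E j i) = - of_real c * expect A p S"
    unfolding expect_scaleR using r(2) by (simp add: scaleR_conv_of_real c_def field_simps flip: of_real_mult)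
  hence "expect A p (\<lambda>E. of_real (centered_adj p n E i j) * G E j i) + of_real c * expect A p R =
     of_real c * expect A p (\<lambda>E. R E - S E)"
    by (simp add: expect_diff algebra_simps)
  also have "cmod \<dots> \<le> c * (8 / (r * t ^ 3))"
    unfolding norm_mult
  proof (intro mult_mono norm_expect_le_const[OF A p])
    fix E
    have "R E - S E = - ((G (E - {e}) j i * G (insert e E) j i - G E j i * G E j i) +
       (G (E - {e}) j j * G (insert e E) i i - G E j j * G E i i))"
      by (simp add: R_def S_def power2_eq_square)
    also have "cmod \<dots> \<le> 2 * (1 / t) * (2 / (r * t\<^sup>2)) + 2 * (1 / t) * (2 / (r * t\<^sup>2))"
      unfolding norm_minus_cancel
      by (intro order_trans[OF norm_triangle_ineq] add_mono norm_mult_diff_le G Gd) (use ij in auto)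
    finally show "cmod (R E - S E) \<le> 8 / (r * t ^ 3)"
      by (simp add: power2_eq_square power3_eq_cube mult_ac)
  qed (use c t r in auto)
  finally show ?thesis by (simp add: A_def R_def[abs_def] c_def r_def)
qed

text \<open>Take the expected trace of \<open>X (X - it)\<^sup>-\<^sup>1 = 1 + it (X - it)\<^sup>-\<^sup>1\<close> and integrate by parts in every entry
  on the left. The terms \<open>G j j * G i i\<close> sum up to \<open>n\<^sup>2 s\<^sup>2\<close>; the terms \<open>(G j i)\<^sup>2\<close> sum up to at most
  \<open>n / t\<^sup>2\<close> in modulus and, like the missing diagonal, are of lower order.\<close>

theorem stieltjes_loop_equation:
  assumes t: "0 < t" and n: "0 < n" and p: "0 \<le> p" "p \<le> 1"
  defines "s \<equiv> \<lambda>E. stieltjes n t (centered_adj p n E)"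
  shows "cmod (1 + \<i> * of_real t * expect (all_edges n) p s
      + of_real (p * (1 - p)) * expect (all_edges n) p (\<lambda>E. (s E)\<^sup>2)) \<le> (8 / t ^ 3 + 3 / t\<^sup>2) / sqrt n"
proof -
  define A where "A = all_edges n"
  have A: "finite A" by (simp add: A_def finite_all_edges)
  define G where "G E = resolvent n t (centered_adj p n E)" for E
  define v where "v = p * (1 - p)"
  have v: "0 \<le> v" "v \<le> 1" using p by (auto simp: v_def intro: mult_le_one)
  define r where "r = sqrt (real n)"
  have r: "r \<ge> 1" "r * r = n" using n by (auto simp: r_def)
  have G: "cmod (G E x y) \<le> 1 / t" if "x < n" "y < n" for E x y
    unfolding G_def using centered_adj_sym t that by (intro norm_resolvent_le)
  define P where "P i j = expect A p (\<lambda>E. of_real (centered_adj p n E i j) * G E j i)" for i j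
  define Q where "Q i j = expect A p (\<lambda>E. (G E j i)\<^sup>2 + G E j j * G E i i)" for i j
  have PQ: "cmod (P i j + of_real (v / n) * Q i j) \<le> v / n * (8 / (r * t ^ 3)) + (if i = j then v / n * (2 / t\<^sup>2) else 0)"
    if ij: "i < n" "j < n" for i j
  proof (cases "i = j")
    case False
    thus ?thesis using expect_entry_times_resolvent[OF t n p ij False]
      by (simp add: P_def Q_def G_def A_def r_def v_def)
  next
    case True
    have "P i j = 0" using True by (simp add: P_def centered_adj_def expect_const[OF A])
    moreover have "cmod (Q i j) \<le> 2 / t\<^sup>2" unfolding Q_def
    proof (rule norm_expect_le_const[OF A p])
      fix E
      have "cmod ((G E j i)\<^sup>2 + G E j j * G E i i) \<le> 1 / t * (1 / t) + 1 / t * (1 / t)"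
        unfolding power2_eq_square
        by (intro order_trans[OF norm_triangle_ineq] add_mono) (use G ij t in \<open>auto simp: norm_mult intro!: mult_mono simp del: times_divide_eq_left times_divide_eq_right\<close>)
      thus "cmod ((G E j i)\<^sup>2 + G E j j * G E i i) \<le> 2 / t\<^sup>2" by (simp add: power2_eq_square)
    qed
    hence "v / n * cmod (Q i j) \<le> v / n * (2 / t\<^sup>2)" using v by (intro mult_left_mono) auto
    ultimately have "cmod (P i j + of_real (v / n) * Q i j) \<le> v / n * (2 / t\<^sup>2)"
      using v by (simp add: norm_mult norm_divide)
    moreover have "0 \<le> v / n * (8 / (r * t ^ 3))" using v r t by simp
    ultimately show ?thesis using True by simp
  qed
  have Psum: "(\<Sum>i<n. \<Sum>j<n. P i j) = of_nat n * (1 + \<i> * of_real t * expect A p s)"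
  proof -
    have "(\<Sum>i<n. \<Sum>j<n. P i j) = expect A p (\<lambda>E. \<Sum>i<n. \<Sum>j<n. of_real (centered_adj p n E i j) * G E j i)"
      by (simp add: P_def expect_sum)
    also have "\<dots> = expect A p (\<lambda>E. of_nat n + \<i> * of_real t * of_nat n * s E)"
    proof (rule expect_cong)
      fix E
      have "(\<Sum>i<n. \<Sum>j<n. of_real (centered_adj p n E i j) * G E j i) = (\<Sum>i<n. 1 + \<i> * of_real t * G E i i)"
        unfolding G_def using resolvent_left[of n "centered_adj p n E" t, OF centered_adj_sym t]
        by (intro sum.cong refl) (simp add: centered_adj_sym)
      also have "\<dots> = of_nat n + \<i> * of_real t * (\<Sum>i<n. G E i i)"
        by (simp add: sum.distrib sum_distrib_left)
      also have "(\<Sum>i<n. G E i i) = of_nat n * s E" using n by (simp add: s_def stieltjes_def G_def)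
      finally show "(\<Sum>i<n. \<Sum>j<n. of_real (centered_adj p n E i j) * G E j i) = of_nat n + \<i> * of_real t * of_nat n * s E"
        by simp
    qed
    also have "\<dots> = of_nat n * (1 + \<i> * of_real t * expect A p s)"
      unfolding expect_add expect_mult_left expect_const[OF A] by (simp add: algebra_simps)
    finally show ?thesis .
  qed
  define D where "D = expect A p (\<lambda>E. \<Sum>i<n. \<Sum>j<n. (G E i j)\<^sup>2)"
  have Qsum: "(\<Sum>i<n. \<Sum>j<n. Q i j) = D + (of_nat n)\<^sup>2 * expect A p (\<lambda>E. (s E)\<^sup>2)"
  proof -
    have "(\<Sum>i<n. \<Sum>j<n. Q i j) = expect A p (\<lambda>E. \<Sum>i<n. \<Sum>j<n. (G E j i)\<^sup>2 + G E j j * G E i i)"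
      by (simp add: Q_def expect_sum)
    also have "\<dots> = expect A p (\<lambda>E. (\<Sum>i<n. \<Sum>j<n. (G E i j)\<^sup>2) + (of_nat n)\<^sup>2 * (s E)\<^sup>2)"
    proof (rule expect_cong)
      fix E
      have "of_nat n * s E = (\<Sum>i<n. G E i i)" using n by (simp add: s_def stieltjes_def G_def)
      hence "(of_nat n * s E) * (of_nat n * s E) = (\<Sum>i<n. \<Sum>j<n. G E i i * G E j j)"
        by (simp only: sum_product)
      hence "(of_nat n)\<^sup>2 * (s E)\<^sup>2 = (\<Sum>i<n. \<Sum>j<n. G E i i * G E j j)"
        by (simp add: power2_eq_square mult_ac)
      thus "(\<Sum>i<n. \<Sum>j<n. (G E j i)\<^sup>2 + G E j j * G E i i) = (\<Sum>i<n. \<Sum>j<n. (G E i j)\<^sup>2) + (of_nat n)\<^sup>2 * (s E)\<^sup>2"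
        by (simp add: sum.distrib mult.commute G_def resolvent_sym[of n t "centered_adj p n E"])
    qed
    finally show ?thesis by (simp add: expect_add expect_mult_left D_def)
  qed
  have D: "cmod D \<le> n / t\<^sup>2" unfolding D_def
  proof (rule norm_expect_le_const[OF A p])
    fix E
    have "cmod (\<Sum>i<n. \<Sum>j<n. (G E i j)\<^sup>2) \<le> (\<Sum>i<n. \<Sum>j<n. (cmod (G E i j))\<^sup>2)"
      by (intro order_trans[OF norm_sum] sum_mono) (simp add: norm_power)
    also have "\<dots> \<le> (\<Sum>i<n. 1 / t\<^sup>2)"
      unfolding G_def by (intro sum_mono resolvent_row_norm[OF centered_adj_sym t]) simp
    finally show "cmod (\<Sum>i<n. \<Sum>j<n. (G E i j)\<^sup>2) \<le> n / t\<^sup>2" by simp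
  qed
  have "cmod (\<Sum>i<n. \<Sum>j<n. P i j + of_real (v / n) * Q i j) \<le>
     (\<Sum>i<n. \<Sum>j<n. v / n * (8 / (r * t ^ 3)) + (if i = j then v / n * (2 / t\<^sup>2) else 0))"
    by (intro order_trans[OF norm_sum] sum_mono PQ) auto
  also have "\<dots> = n * (v * (8 / (r * t ^ 3))) + v * (2 / t\<^sup>2)"
    using n by (simp add: sum.distrib) (simp add: distrib_left)
  finally have 1: "cmod (\<Sum>i<n. \<Sum>j<n. P i j + of_real (v / n) * Q i j) \<le> n * (v * (8 / (r * t ^ 3))) + v * (2 / t\<^sup>2)" .
  define Z where "Z = 1 + \<i> * of_real t * expect A p s + of_real v * expect A p (\<lambda>E. (s E)\<^sup>2)"
  have "(\<Sum>i<n. \<Sum>j<n. P i j + of_real (v / n) * Q i j) = (\<Sum>i<n. \<Sum>j<n. P i j) + of_real (v / n) * (\<Sum>i<n. \<Sum>j<n. Q i j)"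
    by (simp add: sum.distrib sum_distrib_left)
  also have "\<dots> = of_nat n * Z + of_real (v / n) * D"
    unfolding Psum Qsum Z_def using n by (simp add: field_simps power2_eq_square)
  finally have Z: "of_nat n * Z = (\<Sum>i<n. \<Sum>j<n. P i j + of_real (v / n) * Q i j) - of_real (v / n) * D" by simp
  have "n * cmod Z = cmod (of_nat n * Z)" by (simp add: norm_mult)
  also have "\<dots> \<le> cmod (\<Sum>i<n. \<Sum>j<n. P i j + of_real (v / n) * Q i j) + cmod (of_real (v / n) * D)"
    unfolding Z by (rule norm_triangle_ineq4)
  also have "\<dots> = cmod (\<Sum>i<n. \<Sum>j<n. P i j + of_real (v / n) * Q i j) + v / n * cmod D"
    using v by (simp add: norm_mult norm_divide)
  also have "\<dots> \<le> (n * (v * (8 / (r * t ^ 3))) + v * (2 / t\<^sup>2)) + v / n * (n / t\<^sup>2)"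
    using v by (intro add_mono 1 mult_left_mono D) auto
  also have "\<dots> = v * (n * (8 / (r * t ^ 3)) + 3 / t\<^sup>2)" using n by (simp add: field_simps)
  also have "\<dots> \<le> 1 * (n * (8 / (r * t ^ 3)) + 3 / t\<^sup>2)" using v r t by (intro mult_right_mono) auto
  also have "\<dots> \<le> n * ((8 / t ^ 3 + 3 / t\<^sup>2) / r)"
  proof -
    have "1 * r \<le> r * r" using r(1) by (intro mult_right_mono) auto
    hence "3 / t\<^sup>2 * r \<le> 3 / t\<^sup>2 * (r * r)" by (intro mult_left_mono) auto
    hence "3 / t\<^sup>2 \<le> n * (3 / t\<^sup>2) / r" unfolding r(2) using r(1)
      by (subst pos_le_divide_eq) (auto simp only: mult.commute)
    thus ?thesis using r by (simp add: add_divide_distrib distrib_left mult_ac)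
  qed
  finally have "cmod Z \<le> (8 / t ^ 3 + 3 / t\<^sup>2) / r"
    by (rule mult_left_le_imp_le) (use n in simp)
  thus ?thesis by (simp add: Z_def v_def A_def r_def)
qed

section \<open>The expected energy\<close>

text \<open>The positive solution \<open>y\<close> of \<open>v y\<^sup>2 + t y = 1\<close>. The semicircle law of variance \<open>v\<close> has the Stieltjes
  transform \<open>\<i> * y\<close> at \<open>it\<close>.\<close>

definition semicircle_root :: "real \<Rightarrow> real \<Rightarrow> real" where
  "semicircle_root v t = (sqrt (t\<^sup>2 + 4 * v) - t) / (2 * v)"

text \<open>The quadratic factors as \<open>v (w - \<i> y1) (w - \<i> y2)\<close> with \<open>y1\<close> the root defined above and \<open>y2 \<le> - t / v\<close>.
  In the closed upper half plane the second factor has modulus at least \<open>t / v\<close>, so a small residual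
  forces \<open>w\<close> to be close to \<open>\<i> y1\<close>.\<close>

lemma semicircle_root_stable:
  fixes w :: complex
  assumes v: "0 < v" and t: "0 < t" and w: "0 \<le> Im w"
    and \<delta>: "cmod (1 + \<i> * of_real t * w + of_real v * w\<^sup>2) \<le> \<delta>"
  shows "\<bar>Im w - semicircle_root v t\<bar> \<le> \<delta> / t"
proof -
  define q where "q = sqrt (t\<^sup>2 + 4 * v)"
  have q: "q\<^sup>2 = t\<^sup>2 + 4 * v" "t \<le> q" using v t by (auto simp: q_def intro: real_le_rsqrt)
  define y1 where "y1 = (q - t) / (2 * v)"
  define y2 where "y2 = (- q - t) / (2 * v)"
  have y: "v * (y1 + y2) = - t" using v by (simp add: y1_def y2_def field_simps)
  have "v * (y1 * y2) = (t\<^sup>2 - q\<^sup>2) / (4 * v)" using v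
    by (simp add: y1_def y2_def field_simps power2_eq_square)
  hence y': "v * (y1 * y2) = - 1" using v by (simp add: q)
  have "of_real v * (w - \<i> * of_real y1) * (w - \<i> * of_real y2) =
    of_real v * w\<^sup>2 - \<i> * of_real (v * (y1 + y2)) * w - of_real (v * (y1 * y2))"
    by (simp add: algebra_simps power2_eq_square)
  also have "\<dots> = 1 + \<i> * of_real t * w + of_real v * w\<^sup>2" unfolding y y' by simp
  finally have "v * cmod (w - \<i> * of_real y1) * cmod (w - \<i> * of_real y2) \<le> \<delta>"
    using \<delta> v by (metis norm_mult norm_of_real abs_of_pos)
  moreover have "t / v \<le> cmod (w - \<i> * of_real y2)"
  proof -
    have "t / v \<le> - y2" using q v by (simp add: y2_def field_simps)
    also have "\<dots> \<le> Im (w - \<i> * of_real y2)" using w by simp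
    also have "\<dots> \<le> cmod (w - \<i> * of_real y2)" using abs_Im_le_cmod abs_le_D1 by blast
    finally show ?thesis .
  qed
  hence "v * cmod (w - \<i> * of_real y1) * (t / v) \<le> v * cmod (w - \<i> * of_real y1) * cmod (w - \<i> * of_real y2)"
    using v by (intro mult_left_mono) auto
  ultimately have "cmod (w - \<i> * of_real y1) * t \<le> \<delta>" using v by simp
  hence "cmod (w - \<i> * of_real y1) \<le> \<delta> / t" using t by (simp add: pos_le_divide_eq)
  thus ?thesis using abs_Im_le_cmod[of "w - \<i> * of_real y1"]
    by (simp add: semicircle_root_def y1_def q_def)
qed

text \<open>The normalised trace of \<open>A\<^sup>2 (A\<^sup>2 + t\<^sup>2)\<^sup>-\<^sup>1\<close>. Its integral over \<open>t > 0\<close> is \<open>pi / 2\<close> times the energy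
  divided by \<open>n\<close>, and it is determined by the Stieltjes transform at \<open>it\<close>.\<close>

definition damped_trace :: "nat \<Rightarrow> real \<Rightarrow> (nat \<Rightarrow> nat \<Rightarrow> real) \<Rightarrow> real" where
  "damped_trace n t a = (\<Sum>k<n. (eigvals n a k)\<^sup>2 / ((eigvals n a k)\<^sup>2 + t\<^sup>2)) / n"

lemma Im_stieltjes:
  assumes "\<And>i j. i < n \<Longrightarrow> j < n \<Longrightarrow> a i j = a j i" "0 < t"
  shows "Im (stieltjes n t a) = (\<Sum>k<n. t / ((eigvals n a k)\<^sup>2 + t\<^sup>2)) / n"
proof -
  have "(\<Sum>i<n. resolvent n t a i i) = (\<Sum>k<n. 1 / Complex (eigvals n a k) (- t))"
    by (rule resolvent_trace) (use assms in auto)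
  thus ?thesis by (simp only: stieltjes_def Im_divide_of_nat) (simp add: Im_divide)
qed

lemma damped_trace_eq:
  assumes "\<And>i j. i < n \<Longrightarrow> j < n \<Longrightarrow> a i j = a j i" "0 < t" "0 < n"
  shows "damped_trace n t a = 1 - t * Im (stieltjes n t a)"
proof -
  have "Im (stieltjes n t a) = (\<Sum>k<n. t / ((eigvals n a k)\<^sup>2 + t\<^sup>2)) / n"
    by (rule Im_stieltjes) (use assms in auto)
  moreover have "t * (t / (x\<^sup>2 + t\<^sup>2)) = 1 - x\<^sup>2 / (x\<^sup>2 + t\<^sup>2)" for x
  proof -
    have "x\<^sup>2 + t\<^sup>2 \<noteq> 0" using assms(2) by simp
    hence "x\<^sup>2 / (x\<^sup>2 + t\<^sup>2) + t\<^sup>2 / (x\<^sup>2 + t\<^sup>2) = 1"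
      unfolding add_divide_distrib[symmetric] by (rule divide_self)
    thus ?thesis by (simp add: power2_eq_square)
  qed
  ultimately have "t * Im (stieltjes n t a) = (\<Sum>k<n. 1 - (eigvals n a k)\<^sup>2 / ((eigvals n a k)\<^sup>2 + t\<^sup>2)) / n"
    by (simp add: sum_distrib_left)
  also have "\<dots> = 1 - damped_trace n t a"
    using assms(3) by (simp add: sum_subtractf damped_trace_def diff_divide_distrib)
  finally show ?thesis by simp
qed

lemma Im_stieltjes_nonneg:
  assumes "\<And>i j. i < n \<Longrightarrow> j < n \<Longrightarrow> a i j = a j i" "0 < t"
  shows "0 \<le> Im (stieltjes n t a)"
  using assms(2) by (subst Im_stieltjes) (auto simp: assms(1) intro!: sum_nonneg divide_nonneg_nonneg)

text \<open>The variance bound turns the mean of the square in the loop equation into the square of the mean. What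
  remains is a quadratic equation for the mean alone, up to an error of order \<open>1 / sqrt n\<close>, and
  \<open>semicircle_root_stable\<close> applies.\<close>

theorem expect_damped_trace_tendsto:
  assumes t: "0 < t" and p: "0 < p" "p < 1"
  shows "(\<lambda>n. expect (all_edges n) p (\<lambda>E. damped_trace n t (centered_adj p n E)))
    \<longlonglongrightarrow> 1 - t * semicircle_root (p * (1 - p)) t"
proof -
  define v where "v = p * (1 - p)"
  have v: "0 < v" "v \<le> 1" using p by (auto simp: v_def intro: mult_le_one)
  define m where "m n = expect (all_edges n) p (\<lambda>E. stieltjes n t (centered_adj p n E))" for n
  define C where "C = 8 / t ^ 3 + 3 / t\<^sup>2 + 16 / t ^ 4"
  have bound: "\<bar>Im (m n) - semicircle_root v t\<bar> \<le> C / sqrt n / t" if n: "0 < n" for n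
  proof (rule semicircle_root_stable[OF v(1) t])
    have Im_m: "Im (m n) = expect (all_edges n) p (\<lambda>E. Im (stieltjes n t (centered_adj p n E)))"
      by (simp add: m_def expect_def)
    have "expect (all_edges n) p (\<lambda>_. 0 :: real) \<le> Im (m n)" unfolding Im_m
      using p t centered_adj_sym by (intro expect_mono Im_stieltjes_nonneg) auto
    thus "0 \<le> Im (m n)" by (simp add: expect_def)
    let ?s2 = "expect (all_edges n) p (\<lambda>E. (stieltjes n t (centered_adj p n E))\<^sup>2)"
    have "1 + \<i> * of_real t * m n + of_real v * (m n)\<^sup>2 =
       (1 + \<i> * of_real t * m n + of_real v * ?s2) - of_real v * (?s2 - (m n)\<^sup>2)"
      by (simp add: algebra_simps)
    also have "cmod \<dots> \<le> (8 / t ^ 3 + 3 / t\<^sup>2) / sqrt n + 1 * (16 / (n * t ^ 4))"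
    proof (intro order_trans[OF norm_triangle_ineq4] add_mono)
      show "cmod (1 + \<i> * of_real t * m n + of_real v * ?s2) \<le> (8 / t ^ 3 + 3 / t\<^sup>2) / sqrt n"
        unfolding m_def v_def by (rule stieltjes_loop_equation[OF t n]) (use p in auto)
      have "cmod (?s2 - (m n)\<^sup>2) \<le> 16 / (n * t ^ 4)"
        unfolding m_def by (rule stieltjes_variance[OF t n]) (use p in auto)
      thus "cmod (of_real v * (?s2 - (m n)\<^sup>2)) \<le> 1 * (16 / (n * t ^ 4))"
        unfolding norm_mult using v by (intro mult_mono) auto
    qed
    also have "16 / (n * t ^ 4) \<le> 16 / t ^ 4 / sqrt n"
    proof -
      have "1 * sqrt n \<le> sqrt n * sqrt n" using n by (intro mult_right_mono) auto
      hence "sqrt n \<le> n" by simp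
      hence "16 / t ^ 4 / n \<le> 16 / t ^ 4 / sqrt n" using n t by (intro divide_left_mono) auto
      thus ?thesis by (simp add: mult.commute)
    qed
    finally show "cmod (1 + \<i> * of_real t * m n + of_real v * (m n)\<^sup>2) \<le> C / sqrt n"
      by (simp add: C_def add_divide_distrib)
  qed
  have "0 < C" using t by (simp add: C_def add_pos_pos)
  hence "(\<lambda>n. C / sqrt (real n) / t) \<longlonglongrightarrow> 0" using t by real_asymp
  hence "(\<lambda>n. Im (m n) - semicircle_root v t) \<longlonglongrightarrow> 0"
    by (rule Lim_null_comparison[rotated]) (use bound in \<open>auto intro: eventually_sequentiallyI[of 1]\<close>)
  hence "(\<lambda>n. Im (m n)) \<longlonglongrightarrow> semicircle_root v t" by (rule LIM_zero_cancel)
  hence "(\<lambda>n. 1 - t * Im (m n)) \<longlonglongrightarrow> 1 - t * semicircle_root v t" by (intro tendsto_intros)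
  moreover have "\<forall>\<^sub>F n in sequentially. 1 - t * Im (m n) =
     expect (all_edges n) p (\<lambda>E. damped_trace n t (centered_adj p n E))"
  proof (rule eventually_sequentiallyI[of 1])
    fix n :: nat assume "1 \<le> n"
    hence "expect (all_edges n) p (\<lambda>E. damped_trace n t (centered_adj p n E)) =
      expect (all_edges n) p (\<lambda>E. 1 - t * Im (stieltjes n t (centered_adj p n E)))"
      using t centered_adj_sym by (intro expect_cong damped_trace_eq) auto
    also have "\<dots> = 1 - t * expect (all_edges n) p (\<lambda>E. Im (stieltjes n t (centered_adj p n E)))"
      by (simp only: expect_diff expect_mult_left expect_const finite_all_edges)
    finally show "1 - t * Im (m n) = expect (all_edges n) p (\<lambda>E. damped_trace n t (centered_adj p n E))"
      by (simp add: m_def expect_def)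
  qed
  ultimately show ?thesis unfolding v_def by (rule Lim_transform_eventually)
qed

lemma has_bochner_integral_Ioi_FTC:
  fixes f F :: "real \<Rightarrow> real"
  assumes "\<And>x. 0 < x \<Longrightarrow> (F has_real_derivative f x) (at x)" "\<And>x. 0 < x \<Longrightarrow> isCont f x"
    "\<And>x. 0 < x \<Longrightarrow> 0 \<le> f x" "(F \<longlongrightarrow> A) (at_right 0)" "(F \<longlongrightarrow> B) at_top"
  shows "has_bochner_integral lborel (\<lambda>t. indicator {0<..} t *\<^sub>R f t) (B - A)"
proof -
  have ei: "einterval 0 \<infinity> = {0<..}" by (auto simp: einterval_def)
  have lim0: "((F \<circ> real_of_ereal) \<longlongrightarrow> A) (at_right 0)"
    unfolding zero_ereal_def ereal_tendsto_simps by (rule assms(4))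
  have limt: "((F \<circ> real_of_ereal) \<longlongrightarrow> B) (at_left \<infinity>)"
    unfolding ereal_tendsto_simps by (rule assms(5))
  have pos: "0 < x" if "0 < ereal x" for x using that by simp
  have "set_integrable lborel (einterval 0 \<infinity>) f" "(LBINT x=0..\<infinity>. f x) = B - A"
    by (rule interval_integral_FTC_nonneg[where F = F]; use assms lim0 limt in auto)+
  thus ?thesis
    by (simp add: has_bochner_integral_iff set_integrable_def interval_lebesgue_integral_def
        set_lebesgue_integral_def ei)
qed

text \<open>Coulson's integral for the absolute value, with the antiderivative \<open>\<bar>x\<bar> arctan (t / \<bar>x\<bar>)\<close>.\<close>

lemma has_bochner_integral_abs:
  "has_bochner_integral lborel (\<lambda>t. indicator {0<..} t *\<^sub>R (x\<^sup>2 / (x\<^sup>2 + t\<^sup>2))) (pi / 2 * \<bar>x\<bar>)"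
proof (cases "x = 0")
  case True
  thus ?thesis by (simp add: has_bochner_integral_zero)
next
  case False
  define y where "y = \<bar>x\<bar>"
  have y: "y > 0" "x\<^sup>2 = y\<^sup>2" using False by (auto simp: y_def)
  have "has_bochner_integral lborel (\<lambda>t. indicator {0<..} t *\<^sub>R (y\<^sup>2 / (y\<^sup>2 + t\<^sup>2))) (pi / 2 * y - 0)"
  proof (rule has_bochner_integral_Ioi_FTC[where F = "\<lambda>t. y * arctan (t / y)"])
    fix t :: real assume t: "0 < t"
    have nz: "y\<^sup>2 + t\<^sup>2 > 0" using y by (simp add: add_pos_nonneg)
    show "((\<lambda>t. y * arctan (t / y)) has_real_derivative y\<^sup>2 / (y\<^sup>2 + t\<^sup>2)) (at t)"
      using y nz by (auto intro!: derivative_eq_intros simp: field_simps power2_eq_square)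
    show "isCont (\<lambda>t. y\<^sup>2 / (y\<^sup>2 + t\<^sup>2)) t" using nz by (intro continuous_intros) auto
    show "0 \<le> y\<^sup>2 / (y\<^sup>2 + t\<^sup>2)" by simp
  next
    show "((\<lambda>t. y * arctan (t / y)) \<longlongrightarrow> 0) (at_right 0)"
      using y by real_asymp
    show "((\<lambda>t. y * arctan (t / y)) \<longlongrightarrow> pi / 2 * y) at_top"
      using y by real_asymp
  qed
  thus ?thesis by (simp only: y(2) y_def[symmetric] diff_zero)
qed

text \<open>With \<open>q = sqrt (t\<^sup>2 + 4 * v)\<close> the integrand is \<open>1 + (t\<^sup>2 - t * q) / (2 * v)\<close>. Its antiderivative
  \<open>t + (t ^ 3 - q ^ 3) / (6 * v)\<close> tends to 0 at infinity and equals \<open>- 4 / 3 * sqrt v\<close> at 0.\<close>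

lemma has_bochner_integral_semicircle:
  assumes v: "0 < v"
  shows "has_bochner_integral lborel (\<lambda>t. indicator {0<..} t *\<^sub>R (1 - t * semicircle_root v t)) (4 / 3 * sqrt v)"
proof -
  define F where "F t = t + (t ^ 3 - (t\<^sup>2 + 4 * v) * sqrt (t\<^sup>2 + 4 * v)) / (6 * v)" for t
  have "has_bochner_integral lborel (\<lambda>t. indicator {0<..} t *\<^sub>R (1 - t * semicircle_root v t)) (0 - - (4 / 3 * sqrt v))"
  proof (rule has_bochner_integral_Ioi_FTC[where F = F])
    fix t :: real assume t: "0 < t"
    define q where "q = sqrt (t\<^sup>2 + 4 * v)"
    have q: "q > 0" "t\<^sup>2 + 4 * v = q\<^sup>2" "t \<le> q"
      using v t by (auto simp: q_def add_pos_pos intro: real_le_rsqrt)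
    have pos: "0 < t\<^sup>2 + 4 * v" using v by (simp add: add_nonneg_pos)
    have inner: "((\<lambda>t. t\<^sup>2 + 4 * v) has_real_derivative 2 * t) (at t)"
      by (auto intro!: derivative_eq_intros)
    have "(F has_real_derivative 1 + (real 3 * t ^ (3 - Suc 0) -
        (2 * t * q + inverse q / 2 * (2 * t) * (t\<^sup>2 + 4 * v))) / (6 * v)) (at t)"
      unfolding F_def q_def
      by (intro DERIV_add DERIV_ident DERIV_cdivide DERIV_diff DERIV_pow DERIV_mult inner
          DERIV_chain2[OF DERIV_real_sqrt[OF pos] inner])
    also have "1 + (real 3 * t ^ (3 - Suc 0) -
        (2 * t * q + inverse q / 2 * (2 * t) * (t\<^sup>2 + 4 * v))) / (6 * v) = 1 - t * semicircle_root v t"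
      unfolding semicircle_root_def q_def[symmetric] unfolding q(2) using v q(1)
      by (simp add: field_simps power2_eq_square)
    finally show "(F has_real_derivative 1 - t * semicircle_root v t) (at t)" .
    show "isCont (\<lambda>t. 1 - t * semicircle_root v t) t"
      unfolding semicircle_root_def using v by (intro continuous_intros) auto
    have "t * (q - t) \<le> 2 * v"
      using zero_le_power2[of "q - t"] q(2) by (simp add: power2_eq_square algebra_simps)
    thus "0 \<le> 1 - t * semicircle_root v t"
      using v by (simp add: semicircle_root_def q_def field_simps)
  next
    have "isCont F 0" unfolding F_def using v by (intro continuous_intros) auto
    hence "(F \<longlongrightarrow> F 0) (at_right 0)" by (meson filterlim_at_split isCont_def)
    moreover have "F 0 = - (4 / 3 * sqrt v)"
      using v by (simp add: F_def real_sqrt_mult)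
    ultimately show "(F \<longlongrightarrow> - (4 / 3 * sqrt v)) (at_right 0)" by simp
    show "(F \<longlongrightarrow> 0) at_top" unfolding F_def using v by real_asymp
  qed
  thus ?thesis by simp
qed

text \<open>The integrable majorant. Each summand is at most \<open>(1 + x\<^sup>2) / (1 + t\<^sup>2)\<close>, and the squared
  eigenvalues add up to the squared Frobenius norm, which is at most \<open>n\<close> for every graph.\<close>

lemma damped_trace_le:
  assumes n: "0 < n" and p: "0 \<le> p" "p \<le> 1"
  shows "damped_trace n t (centered_adj p n E) \<le> 2 * (1 / (1 + t\<^sup>2))"
proof -
  define l where "l = eigvals n (centered_adj p n E)"
  have lu: "eigen_decomp n (centered_adj p n E) l (eigvecs n (centered_adj p n E))"
    unfolding l_def by (rule eigen_decomp_eigvals[OF centered_adj_sym])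
  have pos: "1 + t\<^sup>2 > 0" by (simp add: add_pos_nonneg)
  have term_le: "x\<^sup>2 / (x\<^sup>2 + t\<^sup>2) \<le> (1 + x\<^sup>2) / (1 + t\<^sup>2)" for x
  proof (cases "x\<^sup>2 + t\<^sup>2 = 0")
    case False
    hence "x\<^sup>2 + t\<^sup>2 > 0" by (metis add_nonneg_nonneg le_less zero_le_power2)
    moreover have "x\<^sup>2 * (1 + t\<^sup>2) \<le> (1 + x\<^sup>2) * (x\<^sup>2 + t\<^sup>2)" by (simp add: algebra_simps)
    ultimately show ?thesis using pos by (simp add: frac_le_eq divide_le_eq field_simps)
  qed simp
  have "(\<Sum>k<n. (l k)\<^sup>2) = (\<Sum>i<n. \<Sum>j<n. (centered_adj p n E i j)\<^sup>2)"
    by (rule sum_eigenvalues_squared[OF lu])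
  also have "\<dots> \<le> (\<Sum>i<n. \<Sum>j<n. 1 / n)"
  proof (intro sum_mono)
    fix i j
    have "(of_bool ({Suc i, Suc j} \<in> E) - p)\<^sup>2 \<le> 1" using p by (auto simp: abs_square_le_1 of_bool_def)
    thus "(centered_adj p n E i j)\<^sup>2 \<le> 1 / n" using n by (simp add: centered_adj_def power_divide divide_right_mono)
  qed
  also have "\<dots> = n" using n by simp
  finally have l2: "(\<Sum>k<n. (l k)\<^sup>2) \<le> n" .
  have "damped_trace n t (centered_adj p n E) \<le> (\<Sum>k<n. (1 + (l k)\<^sup>2) / (1 + t\<^sup>2)) / n"
    unfolding damped_trace_def l_def[symmetric] by (intro divide_right_mono sum_mono term_le) simp
  also have "(\<Sum>k<n. (1 + (l k)\<^sup>2) / (1 + t\<^sup>2)) = (n + (\<Sum>k<n. (l k)\<^sup>2)) / (1 + t\<^sup>2)"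
    by (simp add: sum.distrib flip: sum_divide_distrib)
  also have "\<dots> / n \<le> (n + n) / (1 + t\<^sup>2) / n"
    using l2 pos by (intro divide_right_mono add_mono) auto
  also have "\<dots> = 2 * (1 / (1 + t\<^sup>2))" using n pos by (simp add: divide_simps)
  finally show ?thesis .
qed

lemma has_bochner_integral_expect_damped_trace:
  "has_bochner_integral lborel
     (\<lambda>t. indicator {0<..} t *\<^sub>R expect (all_edges n) p (\<lambda>E. damped_trace n t (centered_adj p n E)))
     (pi / 2 * (expect (all_edges n) p (\<lambda>E. energy_of n (centered_adj p n E)) / n))"
proof -
  have "has_bochner_integral lborel (\<lambda>t. indicator {0<..} t *\<^sub>R damped_trace n t a) (pi / 2 * (energy_of n a / n))"
    if "\<And>i j. a i j = a j i" for a
  proof -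
    have "eigen_decomp n a (eigvals n a) (eigvecs n a)" by (rule eigen_decomp_eigvals) (rule that)
    hence en: "energy_of n a = (\<Sum>k<n. \<bar>eigvals n a k\<bar>)" by (rule energy_eigen_decomp)
    have "has_bochner_integral lborel
       (\<lambda>t. (\<Sum>k<n. indicator {0<..} t *\<^sub>R ((eigvals n a k)\<^sup>2 / ((eigvals n a k)\<^sup>2 + t\<^sup>2))) / n)
       ((\<Sum>k<n. pi / 2 * \<bar>eigvals n a k\<bar>) / n)"
      by (intro has_bochner_integral_divide_zero has_bochner_integral_sum has_bochner_integral_abs) 
    thus ?thesis by (simp add: damped_trace_def en sum_distrib_left)
  qed
  hence "has_bochner_integral lborel (\<lambda>t. \<Sum>E\<in>Pow (all_edges n). (p ^ card E * (1 - p) ^ card (all_edges n - E)) *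
        (indicator {0<..} t *\<^sub>R damped_trace n t (centered_adj p n E)))
      (\<Sum>E\<in>Pow (all_edges n). (p ^ card E * (1 - p) ^ card (all_edges n - E)) *
        (pi / 2 * (energy_of n (centered_adj p n E) / n)))"
    using centered_adj_sym by (intro has_bochner_integral_sum has_bochner_integral_mult_right) auto
  thus ?thesis by (simp add: expect_def sum_distrib_left sum_divide_distrib mult_ac)
qed

theorem expect_energy_tendsto:
  assumes p: "0 < p" "p < 1"
  shows "(\<lambda>n. expect (all_edges n) p (\<lambda>E. energy_of n (centered_adj p n E)) / n)
    \<longlonglongrightarrow> 8 / (3 * pi) * sqrt (p * (1 - p))"
proof -
  define v where "v = p * (1 - p)"
  have v: "0 < v" using p by (simp add: v_def)
  define \<phi> where "\<phi> n t = expect (all_edges n) p (\<lambda>E. damped_trace n t (centered_adj p n E))" for n t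
  have \<phi>: "0 \<le> \<phi> n t" "\<phi> n t \<le> 2 * (1 / (1 + t\<^sup>2))" if "0 < n" for n t
  proof -
    have "expect (all_edges n) p (\<lambda>E. 0) \<le> \<phi> n t" unfolding \<phi>_def
      using p by (intro expect_mono) (auto simp: damped_trace_def intro!: sum_nonneg divide_nonneg_nonneg)
    thus "0 \<le> \<phi> n t" by (simp add: expect_def)
    have "\<phi> n t \<le> expect (all_edges n) p (\<lambda>E. 2 * (1 / (1 + t\<^sup>2)))" unfolding \<phi>_def
      using p that by (intro expect_mono damped_trace_le) auto
    thus "\<phi> n t \<le> 2 * (1 / (1 + t\<^sup>2))" by (simp only: expect_const finite_all_edges)
  qed
  have int: "has_bochner_integral lborel (\<lambda>t. indicator {0<..} t *\<^sub>R \<phi> n t)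
     (pi / 2 * (expect (all_edges n) p (\<lambda>E. energy_of n (centered_adj p n E)) / n))" for n
    unfolding \<phi>_def by (rule has_bochner_integral_expect_damped_trace)
  have "(\<lambda>n. LINT t|lborel. indicator {0<..} t *\<^sub>R \<phi> (Suc n) t) \<longlonglongrightarrow>
     (LINT t|lborel. indicator {0<..} t *\<^sub>R (1 - t * semicircle_root v t))"
  proof (rule integral_dominated_convergence[where w = "\<lambda>t. 2 * (indicator {0<..} t *\<^sub>R (1\<^sup>2 / (1\<^sup>2 + t\<^sup>2)))"])
    show "(\<lambda>t. indicator {0<..} t *\<^sub>R (1 - t * semicircle_root v t)) \<in> borel_measurable lborel"
      by (rule borel_measurable_integrable)
        (use has_bochner_integral_semicircle[OF v] in \<open>simp only: has_bochner_integral_iff\<close>)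
    show "(\<lambda>t. indicator {0<..} t *\<^sub>R \<phi> (Suc n) t) \<in> borel_measurable lborel" for n
      by (rule borel_measurable_integrable) (use int[of "Suc n"] in \<open>simp only: has_bochner_integral_iff\<close>)
    show "integrable lborel (\<lambda>t. 2 * (indicator {0<..} t *\<^sub>R (1\<^sup>2 / (1\<^sup>2 + t\<^sup>2 :: real))))"
      using has_bochner_integral_abs[of 1] by (intro integrable_mult_right) (simp only: has_bochner_integral_iff)
    show "AE t in lborel. (\<lambda>n. indicator {0<..} t *\<^sub>R \<phi> (Suc n) t) \<longlonglongrightarrow> indicator {0<..} t *\<^sub>R (1 - t * semicircle_root v t)"
    proof (rule AE_I2)
      fix t :: real
      show "(\<lambda>n. indicator {0<..} t *\<^sub>R \<phi> (Suc n) t) \<longlonglongrightarrow> indicator {0<..} t *\<^sub>R (1 - t * semicircle_root v t)"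
      proof (cases "0 < t")
        case True
        have "\<phi> n t = expect (all_edges n) p (\<lambda>E. damped_trace n t (centered_adj p n E))" for n by (simp add: \<phi>_def)
        hence "(\<lambda>n. \<phi> n t) \<longlonglongrightarrow> 1 - t * semicircle_root v t"
          using expect_damped_trace_tendsto[OF True p] by (simp add: v_def)
        thus ?thesis by (intro tendsto_scaleR tendsto_const filterlim_compose[OF _ filterlim_Suc])
      qed simp
    qed
    show "AE t in lborel. norm (indicator {0<..} t *\<^sub>R \<phi> (Suc n) t) \<le> 2 * (indicator {0<..} t *\<^sub>R (1\<^sup>2 / (1\<^sup>2 + t\<^sup>2)))" for n
      using \<phi>[of "Suc n"] by (intro AE_I2) (auto simp: indicator_def)
  qed
  hence "(\<lambda>n. pi / 2 * (expect (all_edges (Suc n)) p (\<lambda>E. energy_of (Suc n) (centered_adj p (Suc n) E)) / Suc n))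
     \<longlonglongrightarrow> 4 / 3 * sqrt v"
    using int has_bochner_integral_semicircle[OF v] by (simp only: has_bochner_integral_iff)
  hence "(\<lambda>n. pi / 2 * (expect (all_edges n) p (\<lambda>E. energy_of n (centered_adj p n E)) / n)) \<longlonglongrightarrow> 4 / 3 * sqrt v"
    by (rule LIMSEQ_imp_Suc)
  hence "(\<lambda>n. 2 / pi * (pi / 2 * (expect (all_edges n) p (\<lambda>E. energy_of n (centered_adj p n E)) / n)))
    \<longlonglongrightarrow> 2 / pi * (4 / 3 * sqrt v)" by (rule tendsto_mult_left)
  thus ?thesis by (simp add: v_def field_simps)
qed

section \<open>Concentration and edge weights\<close>

text \<open>Flipping one edge changes \<open>energy / n\<close> by at most \<open>2 / (n * sqrt n)\<close>; the squares of these bounds,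
  over at most \<open>n\<^sup>2\<close> edges, add up to \<open>4 / n\<close>. So the convergence of the means is enough.\<close>

theorem energy_centered_adj_concentrated:
  assumes p: "0 < p" "p < 1" and r: "0 < r"
  defines "L \<equiv> 8 / (3 * pi) * sqrt (p * (1 - p))"
  shows "(\<lambda>n. expect (all_edges n) p (\<lambda>E. of_bool (r \<le> \<bar>energy_of n (centered_adj p n E) / n - L\<bar>))) \<longlonglongrightarrow> (0 :: real)"
proof (rule Lim_null_comparison)
  define F where "F n E = energy_of n (centered_adj p n E) / n" for n E
  define \<mu> where "\<mu> n = expect (all_edges n) p (F n)" for n
  have "\<mu> = (\<lambda>n. expect (all_edges n) p (\<lambda>E. energy_of n (centered_adj p n E)) / n)"
    unfolding \<mu>_def F_def divide_inverse by (intro ext expect_mult_right)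
  hence "\<mu> \<longlonglongrightarrow> L" using expect_energy_tendsto[OF p] by (simp add: L_def)
  hence "\<forall>\<^sub>F n in sequentially. dist (\<mu> n) L < r / 2" using r by (intro tendstoD) auto
  moreover have "\<forall>\<^sub>F n :: nat in sequentially. 0 < n" by (rule eventually_gt_at_top)
  ultimately show "\<forall>\<^sub>F n in sequentially. norm (expect (all_edges n) p (\<lambda>E. of_bool (r \<le> \<bar>energy_of n (centered_adj p n E) / n - L\<bar>)) :: real)
     \<le> 2 * exp (- 2 * (r / 2)\<^sup>2 / (4 / real n))"
  proof eventually_elim
    case (elim n)
    let ?A = "all_edges n"
    have "norm (expect ?A p (\<lambda>E. of_bool (r \<le> \<bar>F n E - L\<bar>) :: real)) \<le> expect ?A p (\<lambda>E. of_bool (r \<le> \<bar>F n E - L\<bar>))"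
      using p by (intro order_trans[OF norm_expect_le]) auto
    also have "\<dots> \<le> expect ?A p (\<lambda>E. of_bool (r / 2 \<le> \<bar>F n E - \<mu> n\<bar>))"
    proof (intro expect_mono)
      fix E
      have "r / 2 \<le> \<bar>F n E - \<mu> n\<bar>" if "r \<le> \<bar>F n E - L\<bar>"
        using elim(1) that unfolding dist_real_def by linarith
      thus "of_bool (r \<le> \<bar>F n E - L\<bar>) \<le> (of_bool (r / 2 \<le> \<bar>F n E - \<mu> n\<bar>) :: real)" by (auto simp: of_bool_def)
    qed (use p in auto)
    also have "\<dots> \<le> 2 * exp (- 2 * (r / 2)\<^sup>2 / (4 / real n))"
      unfolding \<mu>_def
    proof (rule bounded_differences_tail[where c = "\<lambda>_. 2 / (n * sqrt n)"])
      fix E e assume "e \<in> ?A"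
      then obtain x y where xy: "x < n" "y < n" "x \<noteq> y" "e = {Suc x, Suc y}" using all_edgesE by metis
      have "insert e E - {{Suc x, Suc y}} = E - {e} - {{Suc x, Suc y}}" using xy(4) by auto
      hence d: "centered_adj p n (insert e E) i j - centered_adj p n (E - {e}) i j = 1 / sqrt n * sym_unit x y i j" for i j
        by (subst centered_adj_diff[OF xy(3)]) (simp_all add: xy(4))
      have "\<bar>energy_of n (centered_adj p n (insert e E)) - energy_of n (centered_adj p n (E - {e}))\<bar> \<le> 2 * \<bar>1 / sqrt n\<bar>"
        by (rule energy_diff_le_sym_unit[OF centered_adj_sym centered_adj_sym xy(1-3) d])
      hence "\<bar>energy_of n (centered_adj p n (insert e E)) - energy_of n (centered_adj p n (E - {e}))\<bar> / n \<le> 2 / sqrt n / n"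
        by (intro divide_right_mono) auto
      thus "\<bar>F n (insert e E) - F n (E - {e})\<bar> \<le> 2 / (n * sqrt n)"
        by (simp add: F_def mult.commute flip: diff_divide_distrib)
    next
      have "(\<Sum>e\<in>?A. (2 / (n * sqrt n))\<^sup>2) = card ?A * (2 / (n * sqrt n))\<^sup>2" by simp
      also have "\<dots> \<le> (real n)\<^sup>2 * (2 / (n * sqrt n))\<^sup>2" by (intro mult_right_mono card_all_edges_le) auto
      also have "\<dots> = 4 / n" using elim by (simp add: power_divide power_mult_distrib)
      finally show "(\<Sum>e\<in>?A. (2 / (n * sqrt n))\<^sup>2) \<le> 4 / n" .
    qed (use p r elim finite_all_edges in auto)
    finally show ?case by (simp add: F_def)
  qed
  show "(\<lambda>n. 2 * exp (- 2 * (r / 2)\<^sup>2 / (4 / real n))) \<longlonglongrightarrow> 0" using r by real_asymp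
qed

lemma card_incident_edges:
  assumes "i < n"
  shows "card {e \<in> all_edges n. Suc i \<in> e} = n - 1"
proof -
  have "{e \<in> all_edges n. Suc i \<in> e} = (\<lambda>j. {Suc i, j}) ` ({1..n} - {Suc i})"
    using assms by (auto simp: all_edges_def card_2_iff)
  moreover have "inj_on (\<lambda>j. {Suc i, j}) ({1..n} - {Suc i})"
    by (auto simp: inj_on_def doubleton_eq_iff)
  ultimately show ?thesis using assms by (simp add: card_image)
qed

lemma expect_degree:
  assumes i: "i < n"
  shows "expect (all_edges n) p (\<lambda>E. real (degree_of E (Suc i))) = real (n - 1) * p"
proof -
  let ?A = "all_edges n" and ?I = "{e \<in> all_edges n. Suc i \<in> e}"
  have single: "expect ?A p (\<lambda>E. of_bool (e \<in> E) :: real) = p" if "e \<in> ?A" for e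
    by (subst expect_resample[OF finite_all_edges that]) (simp add: expect_const finite_all_edges)
  have "expect ?A p (\<lambda>E. real (degree_of E (Suc i))) = expect ?A p (\<lambda>E. \<Sum>e\<in>?I. of_bool (e \<in> E))"
  proof (rule expect_cong)
    fix E assume "E \<subseteq> ?A"
    hence "{e \<in> E. Suc i \<in> e} = {e \<in> ?I. e \<in> E}" by auto
    thus "real (degree_of E (Suc i)) = (\<Sum>e\<in>?I. of_bool (e \<in> E))"
      by (simp add: degree_of_def finite_all_edges sum_of_bool_eq Int_def)
  qed
  also have "\<dots> = (\<Sum>e\<in>?I. p)" unfolding expect_sum by (intro sum.cong refl single) auto
  finally show ?thesis by (simp add: card_incident_edges[OF i])
qed

lemma degree_tail:
  assumes i: "i < n" and p: "0 \<le> p" "p \<le> 1" and r: "0 < r"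
  shows "expect (all_edges n) p (\<lambda>E. of_bool (r \<le> \<bar>real (degree_of E (Suc i)) - real (n - 1) * p\<bar>))
    \<le> 2 * exp (- 2 * r\<^sup>2 / n)"
  unfolding expect_degree[OF i, symmetric]
proof (rule bounded_differences_tail[where c = "\<lambda>e. of_bool (Suc i \<in> e)"])
  fix E e assume E: "E \<subseteq> all_edges n" "e \<in> all_edges n"
  hence "finite E" using finite_all_edges finite_subset by blast
  moreover have "{x \<in> insert e E. Suc i \<in> x} = (if Suc i \<in> e then insert e {x \<in> E - {e}. Suc i \<in> x} else {x \<in> E - {e}. Suc i \<in> x})"
    by auto
  ultimately have "degree_of (insert e E) (Suc i) = degree_of (E - {e}) (Suc i) + of_bool (Suc i \<in> e)"
    by (simp add: degree_of_def)
  thus "\<bar>real (degree_of (insert e E) (Suc i)) - real (degree_of (E - {e}) (Suc i))\<bar> \<le> of_bool (Suc i \<in> e)"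
    by simp
next
  have "(of_bool b :: real)\<^sup>2 = of_bool b" for b by (cases b) auto
  hence "(\<Sum>e\<in>all_edges n. (of_bool (Suc i \<in> e))\<^sup>2) = real (card {e \<in> all_edges n. Suc i \<in> e})"
    by (simp only:) (simp add: finite_all_edges sum_of_bool_eq Int_def)
  thus "(\<Sum>e\<in>all_edges n. (of_bool (Suc i \<in> e))\<^sup>2) \<le> real n" by (simp add: card_incident_edges[OF i])
qed (use i p r finite_all_edges in auto)

text \<open>The bounded-differences tail of a single degree is exponentially small in \<open>n\<close>, which survives the union
  over \<open>n\<close> vertices. The mean degree is \<open>(n - 1) p\<close> rather than \<open>np\<close>; half of the deviation absorbs this.\<close>

theorem degrees_concentrated:
  fixes p \<eta> :: real
  assumes p: "0 < p" "p < 1" and \<eta>: "0 < \<eta>"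
  shows "(\<lambda>n. expect (all_edges n) p (\<lambda>E. of_bool (\<exists>i<n. \<eta> * (n * p) \<le> \<bar>real (degree_of E (Suc i)) - n * p\<bar>))) \<longlonglongrightarrow> (0 :: real)"
proof (rule Lim_null_comparison)
  have "\<forall>\<^sub>F n in sequentially. 2 / \<eta> < real n"
    by (rule eventually_compose_filterlim[OF eventually_gt_at_top filterlim_real_sequentially])
  thus "\<forall>\<^sub>F n in sequentially. norm (expect (all_edges n) p (\<lambda>E. of_bool (\<exists>i<n. \<eta> * (n * p) \<le> \<bar>real (degree_of E (Suc i)) - n * p\<bar>)) :: real)
     \<le> n * (2 * exp (- 2 * (\<eta> * (n * p) / 2)\<^sup>2 / n))"
  proof eventually_elim
    case (elim n)
    hence n: "n > 0" using \<eta> by (cases n) (auto simp: field_simps)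
    let ?r = "\<eta> * (n * p) / 2"
    have "norm (expect (all_edges n) p (\<lambda>E. of_bool (\<exists>i<n. \<eta> * (n * p) \<le> \<bar>real (degree_of E (Suc i)) - n * p\<bar>)) :: real)
      \<le> expect (all_edges n) p (\<lambda>E. of_bool (\<exists>i<n. \<eta> * (n * p) \<le> \<bar>real (degree_of E (Suc i)) - n * p\<bar>))"
      using p by (intro order_trans[OF norm_expect_le]) auto
    also have "\<dots> \<le> expect (all_edges n) p (\<lambda>E. \<Sum>i<n. of_bool (?r \<le> \<bar>real (degree_of E (Suc i)) - real (n - 1) * p\<bar>))"
    proof (rule expect_mono)
      fix E
      let ?B = "\<lambda>i. ?r \<le> \<bar>real (degree_of E (Suc i)) - real (n - 1) * p\<bar>"
      have sum_nonneg: "0 \<le> (\<Sum>i<n. of_bool (?B i) :: real)" by (intro sum_nonneg) auto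
      show "of_bool (\<exists>i<n. \<eta> * (n * p) \<le> \<bar>real (degree_of E (Suc i)) - n * p\<bar>) \<le> (\<Sum>i<n. of_bool (?B i) :: real)"
      proof (cases "\<exists>i<n. \<eta> * (n * p) \<le> \<bar>real (degree_of E (Suc i)) - n * p\<bar>")
        case True
        then obtain i where i: "i < n" "\<eta> * (n * p) \<le> \<bar>real (degree_of E (Suc i)) - n * p\<bar>" by blast
        have "real (n - 1) * p = n * p - p" using n by (simp add: of_nat_diff algebra_simps)
        moreover have "p \<le> ?r"
        proof -
          have "2 < \<eta> * n" using elim \<eta> by (simp add: field_simps)
          hence "2 * p \<le> \<eta> * n * p" using p by (intro mult_right_mono) auto
          thus ?thesis by (simp add: mult_ac)
        qed
        ultimately have "?B i" using i(2) p by linarith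
        hence "1 = (of_bool (?B i) :: real)" by simp
        also have "\<dots> \<le> (\<Sum>i<n. of_bool (?B i))" using i(1) by (intro member_le_sum) auto
        finally show ?thesis using True by simp
      next
        case False
        thus ?thesis using sum_nonneg by (simp only: False of_bool_eq(1))
      qed
    qed (use p in auto)
    also have "\<dots> \<le> (\<Sum>i<n. 2 * exp (- 2 * ?r\<^sup>2 / n))"
      unfolding expect_sum using p \<eta> n by (intro sum_mono degree_tail) auto
    also have "\<dots> = n * (2 * exp (- 2 * ?r\<^sup>2 / n))" by simp
    finally show ?case .
  qed
  show "(\<lambda>n. n * (2 * exp (- 2 * (\<eta> * (n * p) / 2)\<^sup>2 / n))) \<longlonglongrightarrow> 0" using p \<eta> by real_asymp
qed

text \<open>Sequential regularity is uniform. Otherwise there are bad pairs of arguments for infinitely many \<open>n\<close>,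
  at relative distance tending to 0 from \<open>np\<close>. Placing them along an increasing sequence of indices, and
  \<open>np\<close> at all other indices, gives two sequences that contradict the hypothesis.\<close>

lemma regular_uniform:
  fixes f :: "real \<Rightarrow> real \<Rightarrow> real"
  assumes p: "0 < p"
    and regular: "\<And>x y :: nat \<Rightarrow> real.
      (\<And>n. 0 < x n) \<Longrightarrow> (\<And>n. 0 < y n) \<Longrightarrow>
      (\<lambda>n. x n / (real n * p)) \<longlonglongrightarrow> 1 \<Longrightarrow> (\<lambda>n. y n / (real n * p)) \<longlonglongrightarrow> 1 \<Longrightarrow>
      (\<lambda>n. f (x n) (y n) / f (real n * p) (real n * p)) \<longlonglongrightarrow> 1"
    and \<delta>: "0 < \<delta>"
  shows "\<exists>\<eta>>0. \<forall>\<^sub>F n in sequentially. \<forall>x y. \<bar>x - real n * p\<bar> < \<eta> * (real n * p) \<longrightarrow> \<bar>y - real n * p\<bar> < \<eta> * (real n * p) \<longrightarrow>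
    \<bar>f x y / f (real n * p) (real n * p) - 1\<bar> \<le> \<delta>"
proof (rule ccontr)
  \<comment> \<open>The scale \<open>1 / (k + 2)\<close> is below 1, so that near arguments are positive.\<close>
  define near where "near k n x \<longleftrightarrow> \<bar>x - real n * p\<bar> < 1 / (real k + 2) * (real n * p)" for k n x
  define bad where "bad k n \<longleftrightarrow> 0 < n \<and> (\<exists>x y. near k n x \<and> near k n y \<and> \<delta> < \<bar>f x y / f (real n * p) (real n * p) - 1\<bar>)" for k n
  assume neg: "\<not> ?thesis"
  have freq: "\<exists>n>N. bad k n" for k N
  proof -
    have "0 < 1 / (real k + 2)" by simp
    hence "\<not> (\<forall>\<^sub>F n in sequentially. \<forall>x y. near k n x \<longrightarrow> near k n y \<longrightarrow> \<bar>f x y / f (real n * p) (real n * p) - 1\<bar> \<le> \<delta>)"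
      using neg unfolding near_def by blast
    then obtain n where "Suc N \<le> n" "\<not> (\<forall>x y. near k n x \<longrightarrow> near k n y \<longrightarrow> \<bar>f x y / f (real n * p) (real n * p) - 1\<bar> \<le> \<delta>)"
      unfolding eventually_sequentially by blast
    thus ?thesis unfolding bad_def by (intro exI[of _ n]) (auto simp: not_le)
  qed
  have "\<exists>M. \<forall>k. bad k (M k) \<and> M k < M (Suc k)"
    by (rule dependent_nat_choice) (use freq in blast)+
  then obtain M where M: "\<And>k. bad k (M k)" "\<And>k. M k < M (Suc k)" by blast
  have mono: "strict_mono M" using M(2) by (simp add: strict_mono_Suc_iff)
  have "\<forall>k. \<exists>z. near k (M k) (fst z) \<and> near k (M k) (snd z) \<and> \<delta> < \<bar>f (fst z) (snd z) / f (real (M k) * p) (real (M k) * p) - 1\<bar>"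
    using M(1) unfolding bad_def by fastforce
  then obtain z where z: "\<And>k. near k (M k) (fst (z k))" "\<And>k. near k (M k) (snd (z k))"
    "\<And>k. \<delta> < \<bar>f (fst (z k)) (snd (z k)) / f (real (M k) * p) (real (M k) * p) - 1\<bar>" by metis
  define X where "X h n = (if n \<in> range M then h (z (inv_into UNIV M n)) else if n = 0 then 1 else real n * p)"
    for h :: "real \<times> real \<Rightarrow> real" and n
  have XM: "X h (M k) = h (z k)" for h k
    using strict_mono_imp_inj_on[OF mono] by (simp add: X_def)
  have Mpos: "0 < M k" for k using M(1) by (simp add: bad_def)
  have Xpos: "0 < X h n" if h: "\<And>k. near k (M k) (h (z k))" for h n
  proof (cases "n \<in> range M")
    case True
    then obtain k where k: "n = M k" by blast
    have "1 / (real k + 2) * (real (M k) * p) \<le> 1 * (real (M k) * p)" using p by (intro mult_right_mono) auto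
    hence "0 < h (z k)" using h[of k] by (simp add: near_def abs_less_iff)
    thus ?thesis by (simp add: k XM)
  next
    case False
    thus ?thesis using p by (simp add: X_def)
  qed
  have Xlim: "(\<lambda>n. X h n / (real n * p)) \<longlonglongrightarrow> 1" if h: "\<And>k. near k (M k) (h (z k))" for h
  proof (rule LIMSEQ_I)
    fix r :: real assume r: "0 < r"
    obtain k0 where "inverse (real (Suc k0)) < r" using r reals_Archimedean by blast
    moreover have "1 / (real k0 + 2) \<le> inverse (real (Suc k0))" by (simp add: field_simps)
    ultimately have k0: "1 / (real k0 + 2) < r" by linarith
    show "\<exists>no. \<forall>n\<ge>no. norm (X h n / (real n * p) - 1) < r"
    proof (intro exI[of _ "Suc (M k0)"] allI impI)
      fix n assume n: "Suc (M k0) \<le> n"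
      hence np: "0 < real n * p" using p by simp
      show "norm (X h n / (real n * p) - 1) < r"
      proof (cases "n \<in> range M")
        case True
        then obtain k where k: "n = M k" by blast
        hence "k0 < k" using n mono by (simp add: Suc_le_eq strict_mono_less)
        hence "1 / (real k + 2) \<le> 1 / (real k0 + 2)" by (simp add: frac_le)
        moreover have "norm (X h n / (real n * p) - 1) = \<bar>X h n - real n * p\<bar> / (real n * p)"
        proof -
          have "X h n / (real n * p) - 1 = (X h n - real n * p) / (real n * p)"
            unfolding diff_divide_distrib divide_self[OF less_imp_neq[OF np, symmetric]] ..
          thus ?thesis by (simp only: real_norm_def abs_div_pos[OF np])
        qed
        moreover have "\<bar>X h n - real n * p\<bar> / (real n * p) < 1 / (real k + 2)"
          using h[of k] np by (simp add: k XM near_def pos_divide_less_eq)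
        ultimately show ?thesis using k0 by linarith
      next
        case False
        hence "X h n = real n * p" using n by (simp add: X_def)
        thus ?thesis using p r n by simp
      qed
    qed
  qed
  have "(\<lambda>n. f (X fst n) (X snd n) / f (real n * p) (real n * p)) \<longlonglongrightarrow> 1"
    by (intro regular Xpos Xlim z)
  hence "(\<lambda>k. f (X fst (M k)) (X snd (M k)) / f (real (M k) * p) (real (M k) * p)) \<longlonglongrightarrow> 1"
    using LIMSEQ_subseq_LIMSEQ[OF _ mono] by (force simp: o_def)
  hence "\<forall>\<^sub>F k in sequentially. dist (f (fst (z k)) (snd (z k)) / f (real (M k) * p) (real (M k) * p)) 1 < \<delta>"
    unfolding XM using \<delta> by (rule tendstoD)
  then obtain k where "dist (f (fst (z k)) (snd (z k)) / f (real (M k) * p) (real (M k) * p)) 1 < \<delta>"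
    using eventually_happens'[OF sequentially_bot] by blast
  thus False using z(3)[of k] by (simp add: dist_real_def)
qed

text \<open>Positivity is assumed at integers only, so \<open>np\<close> is compared with a positive integer next to it.\<close>

lemma eventually_weight_pos:
  fixes f :: "real \<Rightarrow> real \<Rightarrow> real"
  assumes p: "0 < p"
    and pos: "\<And>a b :: nat. 1 \<le> a \<Longrightarrow> 1 \<le> b \<Longrightarrow> 0 < f (real a) (real b)"
    and regular: "\<And>x y :: nat \<Rightarrow> real.
      (\<And>n. 0 < x n) \<Longrightarrow> (\<And>n. 0 < y n) \<Longrightarrow>
      (\<lambda>n. x n / (real n * p)) \<longlonglongrightarrow> 1 \<Longrightarrow> (\<lambda>n. y n / (real n * p)) \<longlonglongrightarrow> 1 \<Longrightarrow>
      (\<lambda>n. f (x n) (y n) / f (real n * p) (real n * p)) \<longlonglongrightarrow> 1"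
  shows "\<forall>\<^sub>F n in sequentially. 0 < f (real n * p) (real n * p)"
proof -
  define x where "x n = Suc (nat \<lfloor>real n * p\<rfloor>)" for n
  have x: "real n * p \<le> x n" "x n \<le> real n * p + 1" for n
  proof -
    have "real (x n) = real_of_int \<lfloor>real n * p\<rfloor> + 1" using p by (simp add: x_def)
    thus "real n * p \<le> x n" "x n \<le> real n * p + 1" by linarith+
  qed
  have "(\<lambda>n. real (x n) / (real n * p)) \<longlonglongrightarrow> 1"
  proof (rule tendsto_sandwich[where f = "\<lambda>_. 1" and h = "\<lambda>n. (real n * p + 1) / (real n * p)"])
    show "\<forall>\<^sub>F n in sequentially. 1 \<le> real (x n) / (real n * p)"
      using x p by (intro eventually_sequentiallyI[of 1]) (simp add: pos_le_divide_eq)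
    show "\<forall>\<^sub>F n in sequentially. real (x n) / (real n * p) \<le> (real n * p + 1) / (real n * p)"
      using x p by (intro always_eventually allI divide_right_mono) auto
    show "(\<lambda>n. (real n * p + 1) / (real n * p)) \<longlonglongrightarrow> 1" using p by real_asymp
  qed simp
  hence "(\<lambda>n. f (x n) (x n) / f (real n * p) (real n * p)) \<longlonglongrightarrow> 1"
    by (intro regular) (auto simp: x_def)
  hence "\<forall>\<^sub>F n in sequentially. 0 < f (x n) (x n) / f (real n * p) (real n * p)"
    by (rule order_tendstoD) simp
  thus ?thesis
  proof eventually_elim
    case (elim n)
    moreover have "0 < f (x n) (x n)" by (rule pos) (simp_all add: x_def)
    ultimately show ?case by (simp add: zero_less_divide_iff)
  qed
qed

text \<open>From the weights \<open>f\<close> to the constant weight \<open>c\<close> by the entrywise bound, then from the adjacency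
  matrix to its centered version by the bound for a constant off-diagonal matrix.\<close>

lemma energy_weighted_adj_approx:
  fixes f :: "real \<Rightarrow> real \<Rightarrow> real"
  assumes sym: "\<And>x y. 0 < x \<Longrightarrow> 0 < y \<Longrightarrow> f x y = f y x"
    and p: "0 \<le> p" and n: "0 < n" and E: "E \<subseteq> all_edges n" and c: "0 < c" and \<delta>: "0 \<le> \<delta>"
    and close: "\<And>i j. i < n \<Longrightarrow> j < n \<Longrightarrow>
      \<bar>f (degree_of E (Suc i)) (degree_of E (Suc j)) / c - 1\<bar> \<le> \<delta>"
  shows "\<bar>energy (weighted_adj f n E) / (c * n powr (3 / 2)) - energy_of n (centered_adj p n E) / n\<bar> \<le> \<delta> + 2 * p / sqrt n"
proof -
  define W where "W i j = (if {Suc i, Suc j} \<in> E then f (degree_of E (Suc i)) (degree_of E (Suc j)) else 0)" for i j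
  define B where "B i j = (of_bool ({Suc i, Suc j} \<in> E) :: real)" for i j
  have fin: "finite E" using E finite_all_edges finite_subset by blast
  have deg: "0 < degree_of E i" if "e \<in> E" "i \<in> e" for i e
    using that fin by (auto simp: degree_of_def card_gt_0_iff)
  have W: "W i j = W j i" for i j
  proof (cases "{Suc i, Suc j} \<in> E")
    case True
    hence "0 < degree_of E (Suc i)" "0 < degree_of E (Suc j)" using deg by auto
    thus ?thesis using sym by (simp add: W_def insert_commute)
  qed (simp add: W_def insert_commute)
  have B: "B i j = B j i" for i j by (simp add: B_def insert_commute)
  have "energy (weighted_adj f n E) = energy_of n W" by (simp add: weighted_adj_def W_def)
  moreover have "\<bar>energy_of n W - energy_of n (\<lambda>i j. c * B i j)\<bar> \<le> n * sqrt n * (c * \<delta>)"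
  proof (rule energy_diff_le_entrywise)
    fix i j assume ij: "i < n" "j < n"
    have "\<bar>f (degree_of E (Suc i)) (degree_of E (Suc j)) - c\<bar> = c * \<bar>f (degree_of E (Suc i)) (degree_of E (Suc j)) / c - 1\<bar>"
    proof -
      have "f (degree_of E (Suc i)) (degree_of E (Suc j)) - c = c * (f (degree_of E (Suc i)) (degree_of E (Suc j)) / c - 1)"
        using c by (simp add: right_diff_distrib)
      thus ?thesis using c by (metis abs_mult abs_of_pos)
    qed
    also have "\<dots> \<le> c * \<delta>" using c by (intro mult_left_mono close ij) auto
    finally show "\<bar>W i j - c * B i j\<bar> \<le> c * \<delta>" using c \<delta> by (simp add: W_def B_def)
  qed (use W B c \<delta> in auto)
  moreover have "energy_of n (\<lambda>i j. c * B i j) = c * energy_of n B"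
    using c energy_scale[of n B c] B by simp
  moreover have "\<bar>energy_of n B - energy_of n (\<lambda>i j. sqrt n * centered_adj p n E i j)\<bar> \<le> 2 * real n * \<bar>p\<bar>"
  proof (rule energy_diff_le_offdiag_const)
    fix i j
    have "{Suc i} \<notin> E" for i using E by (auto simp: all_edges_def)
    thus "B i j - sqrt n * centered_adj p n E i j = (if i = j then 0 else p)"
      using n by (simp add: B_def centered_adj_def)
  qed (use B centered_adj_sym in auto)
  moreover have "energy_of n (\<lambda>i j. sqrt n * centered_adj p n E i j) = sqrt n * energy_of n (centered_adj p n E)"
    using energy_scale[of n "centered_adj p n E" "sqrt n"] centered_adj_sym[of p n E] by simp
  ultimately have 1: "\<bar>energy (weighted_adj f n E) - c * energy_of n B\<bar> \<le> n * sqrt n * (c * \<delta>)"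
    and 2: "\<bar>energy_of n B - sqrt n * energy_of n (centered_adj p n E)\<bar> \<le> 2 * real n * p"
    using p by simp_all
  have "c * \<bar>energy_of n B - sqrt n * energy_of n (centered_adj p n E)\<bar> \<le> c * (2 * real n * p)"
    using c by (intro mult_left_mono 2) auto
  hence "\<bar>c * energy_of n B - c * (sqrt n * energy_of n (centered_adj p n E))\<bar> \<le> c * (2 * real n * p)"
    using c by (simp add: abs_mult flip: right_diff_distrib)
  with 1 have 3: "\<bar>energy (weighted_adj f n E) - c * (sqrt n * energy_of n (centered_adj p n E))\<bar>
     \<le> n * sqrt n * (c * \<delta>) + c * (2 * real n * p)" by linarith
  define D where "D = c * (n * sqrt n)"
  have D: "0 < D" using c n by (simp add: D_def)
  have powr: "n powr (3 / 2) = n * sqrt n"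
    using n powr_add[of "real n" 1 "1 / 2"] by (simp add: powr_half_sqrt)
  have "energy (weighted_adj f n E) / (c * n powr (3 / 2)) - energy_of n (centered_adj p n E) / n =
     (energy (weighted_adj f n E) - c * (sqrt n * energy_of n (centered_adj p n E))) / D"
  proof -
    have "energy_of n (centered_adj p n E) / n = c * (sqrt n * energy_of n (centered_adj p n E)) / D"
      unfolding D_def using c n by simp
    thus ?thesis by (simp only: powr D_def diff_divide_distrib)
  qed
  also have "\<bar>\<dots>\<bar> = \<bar>energy (weighted_adj f n E) - c * (sqrt n * energy_of n (centered_adj p n E))\<bar> / D"
    by (rule abs_div_pos[OF D, symmetric])
  also have "\<dots> \<le> (n * sqrt n * (c * \<delta>) + c * (2 * real n * p)) / D"
    using D 3 by (intro divide_right_mono) auto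
  also have "n * sqrt n * (c * \<delta>) + c * (2 * real n * p) = D * (\<delta> + 2 * p / sqrt n)"
    using n by (simp add: D_def distrib_left)
  also have "D * (\<delta> + 2 * p / sqrt n) / D = \<delta> + 2 * p / sqrt n" using D by simp
  finally show ?thesis .
qed

theorem theorem3:
  fixes p :: real and f :: "real \<Rightarrow> real \<Rightarrow> real"
  assumes "0 < p" and "p < 1"
    and sym: "\<And>x y. 0 < x \<Longrightarrow> 0 < y \<Longrightarrow> f x y = f y x"
    and pos: "\<And>a b :: nat. 1 \<le> a \<Longrightarrow> 1 \<le> b \<Longrightarrow> 0 < f (real a) (real b)"
    and growth: "\<exists>C m :: real. 0 < C \<and> 0 < m \<and>
      (\<forall>n a b :: nat. 1 \<le> a \<and> a < n \<and> 1 \<le> b \<and> b < n \<longrightarrow>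
         \<bar>f (real a) (real b)\<bar> \<le> C * real n powr m \<and>
         1 / \<bar>f (real a) (real b)\<bar> \<le> C * real n powr m)"
    and nonzero: "\<And>n :: nat. 1 \<le> n \<Longrightarrow> f (real n * p) (real n * p) \<noteq> 0"
    and regular: "\<And>x y :: nat \<Rightarrow> real.
      (\<And>n. 0 < x n) \<Longrightarrow> (\<And>n. 0 < y n) \<Longrightarrow>
      (\<lambda>n. x n / (real n * p)) \<longlonglongrightarrow> 1 \<Longrightarrow> (\<lambda>n. y n / (real n * p)) \<longlonglongrightarrow> 1 \<Longrightarrow>
      (\<lambda>n. f (x n) (y n) / f (real n * p) (real n * p)) \<longlonglongrightarrow> 1"
  shows "\<forall>\<epsilon>>0. (\<lambda>n. measure_pmf.prob (gnp n p)
      {E. \<bar>energy (weighted_adj f n E) /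
           (f (real n * p) (real n * p) * (8 / (3 * pi)) * sqrt (p * (1 - p)) * real n powr (3 / 2))
           - 1\<bar> > \<epsilon>}) \<longlonglongrightarrow> 0"
proof (intro allI impI)
  fix \<epsilon> :: real assume \<epsilon>: "0 < \<epsilon>"
  note p = assms(1,2)
  define L where "L = 8 / (3 * pi) * sqrt (p * (1 - p))"
  have L: "0 < L" using p by (simp add: L_def)
  define c where "c n = f (real n * p) (real n * p)" for n :: nat
  \<comment> \<open>Of the tolerance \<open>\<epsilon> * L\<close>, a quarter each goes to the weights and to the diagonal shift by \<open>p\<close>, and half to the fluctuation of the energy.\<close>
  define \<delta> where "\<delta> = \<epsilon> * L / 4"
  have \<delta>: "0 < \<delta>" using \<epsilon> L by (simp add: \<delta>_def)
  have "\<exists>\<eta>>0. \<forall>\<^sub>F n in sequentially. \<forall>x y. \<bar>x - real n * p\<bar> < \<eta> * (real n * p) \<longrightarrow>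
      \<bar>y - real n * p\<bar> < \<eta> * (real n * p) \<longrightarrow> \<bar>f x y / c n - 1\<bar> \<le> \<delta>"
    unfolding c_def by (rule regular_uniform[OF p(1) _ \<delta>]) (fact regular)
  then obtain \<eta> where \<eta>: "0 < \<eta>" "\<forall>\<^sub>F n in sequentially. \<forall>x y. \<bar>x - real n * p\<bar> < \<eta> * (real n * p) \<longrightarrow>
      \<bar>y - real n * p\<bar> < \<eta> * (real n * p) \<longrightarrow> \<bar>f x y / c n - 1\<bar> \<le> \<delta>" by blast
  define bad where "bad n E \<longleftrightarrow> (\<exists>i<n. \<eta> * (n * p) \<le> \<bar>real (degree_of E (Suc i)) - n * p\<bar>)" for n :: nat and E
  define far where "far n E \<longleftrightarrow> 2 * \<delta> \<le> \<bar>energy_of n (centered_adj p n E) / n - L\<bar>" for n :: nat and E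
  let ?S = "\<lambda>n. {E. \<bar>energy (weighted_adj f n E) /
           (f (real n * p) (real n * p) * (8 / (3 * pi)) * sqrt (p * (1 - p)) * real n powr (3 / 2)) - 1\<bar> > \<epsilon>}"
  show "(\<lambda>n. measure_pmf.prob (gnp n p) (?S n)) \<longlonglongrightarrow> 0"
  proof (rule Lim_null_comparison)
    have "(\<lambda>n. 2 * p / sqrt (real n)) \<longlonglongrightarrow> 0" by real_asymp
    hence "\<forall>\<^sub>F n in sequentially. 2 * p / sqrt (real n) < \<delta>" using \<delta> by (rule order_tendstoD)
    moreover have "\<forall>\<^sub>F n in sequentially. 0 < c n"
      unfolding c_def by (rule eventually_weight_pos[OF p(1)]) (fact pos, fact regular)
    moreover have "\<forall>\<^sub>F n :: nat in sequentially. 0 < n" by (rule eventually_gt_at_top)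
    ultimately show "\<forall>\<^sub>F n in sequentially. norm (measure_pmf.prob (gnp n p) (?S n)) \<le>
       expect (all_edges n) p (\<lambda>E. of_bool (bad n E)) + expect (all_edges n) p (\<lambda>E. of_bool (far n E))"
      using \<eta>(2)
    proof eventually_elim
      case (elim n)
      have "measure_pmf.prob (gnp n p) (?S n) = expect (all_edges n) p (\<lambda>E. of_bool (E \<in> ?S n))"
        using p by (intro prob_gnp) auto
      also have "\<dots> \<le> expect (all_edges n) p (\<lambda>E. of_bool (bad n E) + of_bool (far n E))"
      proof (rule expect_mono)
        fix E assume E: "E \<subseteq> all_edges n"
        have "E \<notin> ?S n" if nb: "\<not> bad n E" and nf: "\<not> far n E"
        proof -
          define R where "R = energy (weighted_adj f n E) / (c n * n powr (3 / 2))"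
          have "\<bar>R - energy_of n (centered_adj p n E) / n\<bar> \<le> \<delta> + 2 * p / sqrt n"
            unfolding R_def
          proof (rule energy_weighted_adj_approx[OF sym _ elim(3) E elim(2)])
            fix i j assume "i < n" "j < n"
            thus "\<bar>f (degree_of E (Suc i)) (degree_of E (Suc j)) / c n - 1\<bar> \<le> \<delta>"
              using nb elim(4) by (simp add: bad_def not_le)
          qed (use p \<delta> in auto)
          hence "\<bar>R - L\<bar> < 4 * \<delta>" using elim(1) nf by (simp add: far_def not_le)
          hence "\<bar>R - L\<bar> / L < \<epsilon>" using L by (simp add: \<delta>_def pos_divide_less_eq)
          moreover have "R / L - 1 = (R - L) / L" using L by (simp add: diff_divide_distrib)
          ultimately have "\<bar>R / L - 1\<bar> < \<epsilon>" by (simp only: abs_div_pos[OF L])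
          moreover have "energy (weighted_adj f n E) /
           (f (real n * p) (real n * p) * (8 / (3 * pi)) * sqrt (p * (1 - p)) * real n powr (3 / 2)) = R / L"
            by (simp add: R_def L_def c_def mult_ac)
          ultimately show ?thesis by simp
        qed
        thus "of_bool (E \<in> ?S n) \<le> (of_bool (bad n E) + of_bool (far n E) :: real)" by (auto simp: of_bool_def)
      qed (use p in auto)
      finally show ?case unfolding expect_add by simp
    qed
    have "(\<lambda>n. expect (all_edges n) p (\<lambda>E. of_bool (bad n E))) \<longlonglongrightarrow> (0 :: real)"
      unfolding bad_def by (rule degrees_concentrated[OF p \<eta>(1)])
    moreover have "(\<lambda>n. expect (all_edges n) p (\<lambda>E. of_bool (far n E))) \<longlonglongrightarrow> (0 :: real)"
      unfolding far_def L_def by (rule energy_centered_adj_concentrated[OF p]) (use \<delta> in simp)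
    ultimately have "(\<lambda>n. expect (all_edges n) p (\<lambda>E. of_bool (bad n E)) + expect (all_edges n) p (\<lambda>E. of_bool (far n E))) \<longlonglongrightarrow> 0 + (0 :: real)"
      by (rule tendsto_add)
    thus "(\<lambda>n. expect (all_edges n) p (\<lambda>E. of_bool (bad n E)) + expect (all_edges n) p (\<lambda>E. of_bool (far n E))) \<longlonglongrightarrow> (0 :: real)"
      by simp
  qed
qed

end
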